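(* Let $p>4$ and assume that $h$ satisfies $(h_1)$ and $(h_2)$. Then equation (E) has a ground state solution $u\in H^{s,2}$, i.e. $u\in\mathcal{N}_{s,2}$, $J_{s,2}'(u)=0$ and $J_{s,2}(u)=\inf_{v\in\mathcal{N}_{s,2}}J_{s,2}(v)$.
   Context: Let $d\ge 1$ and $s\in(0,1)$. $\mathbb{Z}^d$ is the integer lattice graph (vertices $\mathbb{Z}^d$, edges between $x,y$ with $\sum_i|x_i-y_i|=1$), with graph distance $|x-y|=\sum_{i=1}^d|x_i-y_i|$ and counting measure $\mu$; $\int_{\mathbb{Z}^d}f\,d\mu:=\sum_{x\in\mathbb{Z}^d}f(x)$. The weight $w_s(x,y)$, defined for $x\neq y$, is symmetric, positive, and satisfies $c_{s,d}|x-y|^{-d-2s}\le w_s(x,y)\le C_{s,d}|x-y|^{-d-2s}$ for some constants $0<c_{s,d}\le C_{s,d}$. For $u,v:\mathbb{Z}^d\to\mathbb{R}$ set $\nabla^s u\nabla^s v(x)=\frac12\sum_{y\neq x}w_s(x,y)(u(x)-u(y))(v(x)-v(y))$, $|\nabla^s u|^2(x)=\nabla^s u\nabla^s u(x)$, $\|\nabla^s u\|_2^2:=\int_{\mathbb{Z}^d}|\nabla^s u|^2d\mu$, and $(-\Delta)^s u(x)=\sum_{y\neq x}w_s(x,y)(u(x)-u(y))$; $\|u\|_q$ denotes the $\ell^q(\mathbb{Z}^d)$ norm. Fix constants $a,b>0$ and $p>2$. The potential $h:\mathbb{Z}^d\to\mathbb{R}$ may satisfy: $(h_1)$ there is $h_0>0$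 with $h(x)\ge h_0$ for all $x$; $(h_2)$ there is $x_0\in\mathbb{Z}^d$ with $h(x)\to\infty$ as $|x-x_0|\to\infty$. $W^{s,2}(\mathbb{Z}^d)$ is the completion of finitely supported functions under $\|u\|_{W^{s,2}}^2=\int(|\nabla^s u|^2+u^2)d\mu$, and $H^{s,2}=\{u\in W^{s,2}:\int h u^2d\mu<\infty\}$ is the Hilbert space with inner product $\langle u,v\rangle_{H^{s,2}}=\int(a\nabla^s u\nabla^s v+huv)d\mu$ and norm $\|u\|_{H^{s,2}}$. Equation (E) is $\left(a+b\int_{\mathbb{Z}^d}|\nabla^s u|^2d\mu\right)(-\Delta)^s u+h(x)u=|u|^{p-2}u\log u^2$ on $\mathbb{Z}^d$ (with $|t|^{p-2}t\log t^2:=0$ at $t=0$). The energy is $J_{s,2}(u)=\frac12\|u\|_{H^{s,2}}^2+\frac b4\|\nabla^s u\|_2^4+\frac{2}{p^2}\int|u|^pd\mu-\frac1p\int|u|^p\log u^2d\mu$, a $C^1$ functional on $H^{s,2}$ with $\langle J_{s,2}'(u),\phi\rangle=\int(a\nabla^s u\nabla^s\phi+hu\phi)d\mu+b\|\nabla^s u\|_2^2\int\nabla^s u\nabla^s\phi\,d\mu-\int|u|^{p-2}u\phi\log u^2d\mu$. A weak solution is a critical point of $J_{s,2}$; nontrivial means $\neq0$. $u^+=\max\{u,0\}$, $u^-=\min\{u,0\}$. Nehari manifold: $\mathcal{N}_{s,2}=\{v\in H^{s,2}\setminus\{0\}:\langle J_{s,2}'(v),v\rangle=0\}$. Sign-changing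 Nehari set: $\mathcal{M}_{s,2}=\{v\in H^{s,2}: v^\pm\neq0,\ \langle J_{s,2}'(v),v^+\rangle=\langle J_{s,2}'(v),v^-\rangle=0\}$. A ground state solution is a nontrivial weak solution $u$ with $J_{s,2}(u)=\inf_{\mathcal{N}_{s,2}}J_{s,2}$; a sign-changing solution is a weak solution $u$ with $u^\pm\not\equiv0$; a ground state sign-changing solution is a sign-changing solution $u$ with $J_{s,2}(u)=\inf_{\mathcal{M}_{s,2}}J_{s,2}$. For $u\in H^{s,2}$, $K(u)=\sum_{x}\sum_{y\neq x}w_s(x,y)[u^+(y)u^-(x)+u^-(y)u^+(x)]$. *)

theory Defs
  imports "HOL-Analysis.Analysis"
begin

text \<open>Points of the lattice Z^d are vectors int^'n, d = CARD('n).
  Functions on Z^d are real-valued functions on int^'n.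
  The weight w is a parameter; only its values off the diagonal are used.\<close>

definition dist1 :: "int^'n \<Rightarrow> int^'n \<Rightarrow> int" where
  "dist1 x y = (\<Sum>i\<in>UNIV. \<bar>x$i - y$i\<bar>)"

definition gradprod :: "(int^'n \<Rightarrow> int^'n \<Rightarrow> real) \<Rightarrow> (int^'n \<Rightarrow> real) \<Rightarrow> (int^'n \<Rightarrow> real) \<Rightarrow> int^'n \<Rightarrow> real" where
  "gradprod w u v x = 1/2 * (\<Sum>\<^sub>\<infinity>y\<in>{y. y \<noteq> x}. w x y * (u x - u y) * (v x - v y))"

definition gradsq :: "(int^'n \<Rightarrow> int^'n \<Rightarrow> real) \<Rightarrow> (int^'n \<Rightarrow> real) \<Rightarrow> int^'n \<Rightarrow> real" where
  "gradsq w u x = gradprod w u u x"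

definition gradnorm2 :: "(int^'n \<Rightarrow> int^'n \<Rightarrow> real) \<Rightarrow> (int^'n \<Rightarrow> real) \<Rightarrow> real" where
  "gradnorm2 w u = (\<Sum>\<^sub>\<infinity>x. gradsq w u x)"

definition fin_supp :: "(int^'n \<Rightarrow> real) \<Rightarrow> bool" where
  "fin_supp u \<longleftrightarrow> finite {x. u x \<noteq> 0}"

definition Wnorm2 :: "(int^'n \<Rightarrow> int^'n \<Rightarrow> real) \<Rightarrow> (int^'n \<Rightarrow> real) \<Rightarrow> real" where
  "Wnorm2 w u = (\<Sum>\<^sub>\<infinity>x. gradsq w u x + (u x)^2)"

text \<open>W^{s,2}: completion of finitely supported functions under the W-norm,
  realised as the functions of finite W-norm that are W-norm limits of
  finitely supported functions.\<close>
definition Wsp :: "(int^'n \<Rightarrow> int^'n \<Rightarrow> real) \<Rightarrow> (int^'n \<Rightarrow> real) set" where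
  "Wsp w = {u. (\<lambda>x. gradsq w u x + (u x)^2) summable_on UNIV \<and>
     (\<exists>\<phi>::nat \<Rightarrow> int^'n \<Rightarrow> real. (\<forall>n. fin_supp (\<phi> n)) \<and>
        (\<lambda>n. Wnorm2 w (\<lambda>x. \<phi> n x - u x)) \<longlonglongrightarrow> 0)}"

definition Hsp :: "(int^'n \<Rightarrow> int^'n \<Rightarrow> real) \<Rightarrow> (int^'n \<Rightarrow> real) \<Rightarrow> (int^'n \<Rightarrow> real) set" where
  "Hsp w h = {u \<in> Wsp w. (\<lambda>x. h x * (u x)^2) summable_on UNIV}"

definition Hinner :: "(int^'n \<Rightarrow> int^'n \<Rightarrow> real) \<Rightarrow> real \<Rightarrow> (int^'n \<Rightarrow> real) \<Rightarrow> (int^'n \<Rightarrow> real) \<Rightarrow> (int^'n \<Rightarrow> real) \<Rightarrow> real" where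
  "Hinner w a h u v = (\<Sum>\<^sub>\<infinity>x. a * gradprod w u v x + h x * u x * v x)"

definition flog :: "real \<Rightarrow> real \<Rightarrow> real" where
  "flog p t = (if t = 0 then 0 else \<bar>t\<bar> powr (p - 2) * t * ln (t^2))"

definition plog :: "real \<Rightarrow> real \<Rightarrow> real" where
  "plog p t = (if t = 0 then 0 else \<bar>t\<bar> powr p * ln (t^2))"

definition Jfun :: "(int^'n \<Rightarrow> int^'n \<Rightarrow> real) \<Rightarrow> real \<Rightarrow> real \<Rightarrow> (int^'n \<Rightarrow> real) \<Rightarrow> real \<Rightarrow> (int^'n \<Rightarrow> real) \<Rightarrow> real" where
  "Jfun w a b h p u = 1/2 * Hinner w a h u u + b/4 * (gradnorm2 w u)^2
     + 2 / p^2 * (\<Sum>\<^sub>\<infinity>x. \<bar>u x\<bar> powr p) - 1/p * (\<Sum>\<^sub>\<infinity>x. plog p (u x))"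

definition dJ :: "(int^'n \<Rightarrow> int^'n \<Rightarrow> real) \<Rightarrow> real \<Rightarrow> real \<Rightarrow> (int^'n \<Rightarrow> real) \<Rightarrow> real \<Rightarrow> (int^'n \<Rightarrow> real) \<Rightarrow> (int^'n \<Rightarrow> real) \<Rightarrow> real" where
  "dJ w a b h p u \<phi> = Hinner w a h u \<phi> + b * gradnorm2 w u * (\<Sum>\<^sub>\<infinity>x. gradprod w u \<phi> x)
     - (\<Sum>\<^sub>\<infinity>x. flog p (u x) * \<phi> x)"

definition Nehari :: "(int^'n \<Rightarrow> int^'n \<Rightarrow> real) \<Rightarrow> real \<Rightarrow> real \<Rightarrow> (int^'n \<Rightarrow> real) \<Rightarrow> real \<Rightarrow> (int^'n \<Rightarrow> real) set" where
  "Nehari w a b h p = {v \<in> Hsp w h. v \<noteq> (\<lambda>x. 0) \<and> dJ w a b h p v v = 0}"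

end

theory Submission
  imports Defs
begin

text \<open>
  The upper bound on the weight makes its row sums bounded, so \<open>W\<^bsup>s,2\<^esup>\<close> is \<open>\<ell>\<^sup>2\<close>, the Dirichlet form is
  bounded on it, and \<open>H\<^bsup>s,2\<^esup>\<close> is the \<open>\<ell>\<^sup>2\<close> space with weight \<open>h\<close>.
  For \<open>p > 4\<close> every ray \<open>t u\<close> meets the Nehari manifold exactly once, at the maximum of \<open>J\<close> on the ray.
  On the manifold \<open>J = (1/2 - 1/p) \<parallel>u\<parallel>\<^sup>2 + (1/4 - 1/p) b \<parallel>\<nabla>u\<parallel>\<^sup>4 + 2/p\<^sup>2 \<parallel>u\<parallel>\<^sub>p\<^sup>p\<close>, so a minimizing
  sequence is bounded; since \<open>h\<close> tends to infinity, it converges in \<open>\<ell>\<^sup>2\<close> along a subsequence.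
  The limit is not zero, because the logarithm forces each function on the manifold to exceed \<open>1\<close>
  in modulus somewhere, and by lower semicontinuity it is scaled back to the manifold by some
  \<open>t \<le> 1\<close>, which does not raise the energy above the infimum. A minimizer is critical because the
  energy of \<open>t (u + \<epsilon> \<phi>)\<close> is compared with that of \<open>t u\<close>, which is at most that of \<open>u\<close>.
\<close>

section \<open>The nonlinearity and the fibering map\<close>

text \<open>The terms of \<open>pot u u\<close> are nonnegative, so a bound on the sum bounds
  \<open>u\<close> in sup norm. On a bounded range \<open>flog p\<close> is Lipschitz and vanishes
  at 0, hence the nonlinear terms of the energy are at most a constant times t^2; their summability
  and convergence rest on this estimate. Along the minimizing subsequence the Dirichlet form and the
  nonlinear sums converge to their values at the limit, but \<open>pot\<close> may drop; that is why
  the limit has to be scaled back. The condition p > 4 makes t^p dominate the quartic Kirchhoff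
  term, which decides both the sign of the fibering derivative and the positivity of 1/4 - 1/p.
  Criticality is reached through inequalities: the energy at t u + e \<phi> has an upper bound with
  a remainder of order e^2, uniform for t in [0, 2]. Uniformity matters because the t that puts t (u
  + e \<phi>) on the manifold depends on e and comes from the intermediate value theorem, which
  controls nothing but its distance from 1.\<close>

lemma summable_on_real_comparison:
  fixes f g :: "'a \<Rightarrow> real"
  assumes "g summable_on A" "\<And>x. x \<in> A \<Longrightarrow> \<bar>f x\<bar> \<le> g x"
  shows "f summable_on A"
proof -
  have "(\<lambda>x. norm (f x)) summable_on A"
    by (rule summable_on_comparison_test[OF assms(1)]) (use assms(2) in auto)
  then show ?thesis by (rule abs_summable_summable)
qed

lemma abs_infsum_le:
  fixes f g :: "'a \<Rightarrow> real"
  assumes g: "g summable_on A" and fg: "\<And>x. x \<in> A \<Longrightarrow> \<bar>f x\<bar> \<le> g x"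
  shows "\<bar>infsum f A\<bar> \<le> infsum g A"
proof -
  have "f summable_on A" using assms by (rule summable_on_real_comparison)
  then have "norm (infsum f A) \<le> infsum g A"
    using fg by (intro norm_infsum_le[OF has_sum_infsum has_sum_infsum[OF g]]) auto
  then show ?thesis by simp
qed

lemma infsum_diff_real:
  fixes f g :: "'a \<Rightarrow> real"
  assumes "f summable_on A" "g summable_on A"
  shows "infsum (\<lambda>x. f x - g x) A = infsum f A - infsum g A"
  using infsum_add[OF assms(1) summable_on_uminus[THEN iffD2, OF assms(2)]]
  by (simp add: infsum_uminus)

lemma summable_on_diff_real:
  fixes f g :: "'a \<Rightarrow> real"
  assumes "f summable_on A" "g summable_on A"
  shows "(\<lambda>x. f x - g x) summable_on A"
  using summable_on_add[OF assms(1) summable_on_uminus[THEN iffD2, OF assms(2)]] by simp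

lemma abs_mult_le_sum_squares: "\<bar>x * y\<bar> \<le> x\<^sup>2 + y\<^sup>2" for x y :: real
proof -
  have "0 \<le> (\<bar>x\<bar> - \<bar>y\<bar>)\<^sup>2" by simp
  then have "2 * (\<bar>x\<bar> * \<bar>y\<bar>) \<le> x\<^sup>2 + y\<^sup>2" by (simp add: power2_diff)
  moreover have "0 \<le> \<bar>x\<bar> * \<bar>y\<bar>" by simp
  ultimately have "\<bar>x\<bar> * \<bar>y\<bar> \<le> x\<^sup>2 + y\<^sup>2" by linarith
  then show ?thesis by (simp add: abs_mult)
qed

lemma square_add_le: "(x + y)\<^sup>2 \<le> 2 * x\<^sup>2 + 2 * y\<^sup>2" for x y :: real
proof -
  have "0 \<le> (x - y)\<^sup>2" by simp
  then show ?thesis by (simp add: power2_diff power2_sum)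
qed

lemma square_diff_le: "(x - y)\<^sup>2 \<le> 2 * x\<^sup>2 + 2 * y\<^sup>2" for x y :: real
  using square_add_le[of x "- y"] by simp

text \<open>Tychonoff: the product of the intervals [-R, R] is compact, and over a countable index
  type compactness of the product implies sequential compactness. Convergence in the product is
  pointwise convergence.\<close>

lemma bounded_pointwise_convergent_subseq:
  fixes f :: "nat \<Rightarrow> 'a::countable \<Rightarrow> real"
  assumes "\<And>n x. \<bar>f n x\<bar> \<le> R"
  obtains g r where "strict_mono (r :: nat \<Rightarrow> nat)" "\<And>x. (\<lambda>n. f (r n) x) \<longlonglongrightarrow> g x"
proof -
  have "compactin (product_topology (\<lambda>_::'a. euclidean) UNIV) (Pi\<^sub>E UNIV (\<lambda>_. {-R..R::real}))"
    by (simp add: compactin_PiE)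
  then have "compact (Pi\<^sub>E (UNIV::'a set) (\<lambda>_. {-R..R::real}))"
    by (simp add: euclidean_product_topology)
  then have "seq_compact (Pi\<^sub>E (UNIV::'a set) (\<lambda>_. {-R..R::real}))"
    by (rule compact_imp_seq_compact)
  moreover have "\<forall>n. f n \<in> Pi\<^sub>E UNIV (\<lambda>_. {-R..R})"
    using assms by (auto simp: PiE_def abs_le_iff minus_le_iff)
  ultimately obtain g r where r: "strict_mono (r :: nat \<Rightarrow> nat)" "(f \<circ> r) \<longlonglongrightarrow> g"
    by (rule seq_compactE)
  have "(\<lambda>n. f (r n) x) \<longlonglongrightarrow> g x" for x
    using continuous_on_tendsto_compose[OF continuous_on_product_coordinates[of x] r(2)]
    by (simp add: o_def)
  with r(1) show ?thesis by (rule that)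
qed

text \<open>Supplies the derivatives of \<open>flog p\<close> and \<open>log_prim p\<close> at 0,
  where the product rule does not apply to the logarithm.\<close>

lemma deriv_zero_if_quadratic_bound:
  fixes g :: "real \<Rightarrow> real"
  assumes "\<And>t. \<bar>t\<bar> \<le> 1 \<Longrightarrow> \<bar>g t\<bar> \<le> K * t\<^sup>2"
  shows "(g has_real_derivative 0) (at 0)"
proof -
  have g0: "g 0 = 0" using assms[of 0] by simp
  have ev: "\<forall>\<^sub>F t in at 0. norm (g t / t) \<le> K * \<bar>t\<bar>"
    unfolding eventually_at
  proof (intro exI[of _ 1] conjI ballI impI)
    fix t :: real assume "t \<noteq> 0 \<and> dist t 0 < 1"
    then show "norm (g t / t) \<le> K * \<bar>t\<bar>"
      using assms[of t] by (simp add: field_simps power2_eq_square)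
  qed simp
  have "((\<lambda>t. K * \<bar>t\<bar>) \<longlongrightarrow> K * \<bar>0\<bar>) (at 0)"
    by (intro tendsto_intros)
  then have "((\<lambda>t. g t / t) \<longlongrightarrow> 0) (at 0)"
    by (intro Lim_null_comparison[OF ev]) simp
  then show ?thesis by (simp add: DERIV_def g0)
qed

section \<open>Growth, Lipschitz bounds and antiderivative of the logarithmic nonlinearity\<close>

lemma abs_ln_le: "\<bar>ln x\<bar> \<le> x + 1 / x" if "0 < x" for x :: real
proof -
  have "ln x \<le> x" using ln_le_minus_one[OF that] by simp
  moreover have "- ln x \<le> 1 / x"
    using ln_le_minus_one[of "1 / x"] that by (simp add: ln_div)
  moreover have "0 < 1 / x" using that by simp
  ultimately show ?thesis using that by linarith
qed

text \<open>The bound t + 1/t for |ln t| trades the logarithm for one power up and one power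
  down.\<close>

lemma abs_powr_ln_le:
  fixes t q :: real
  assumes "0 < t"
  shows "\<bar>t powr q * ln (t\<^sup>2)\<bar> \<le> 2 * (t powr (q + 1) + t powr (q - 1))"
proof -
  have "\<bar>t powr q * ln (t\<^sup>2)\<bar> = t powr q * (2 * \<bar>ln t\<bar>)"
    using assms by (simp add: abs_mult ln_realpow)
  also have "\<dots> \<le> t powr q * (2 * (t + 1 / t))"
    using abs_ln_le[OF assms] by (intro mult_left_mono) auto
  also have "\<dots> = 2 * (t powr (q + 1) + t powr (q - 1))"
    using assms by (simp add: powr_add powr_diff field_simps)
  finally show ?thesis .
qed

lemma plog_eq_flog_mult: "plog p t = flog p t * t"
proof (cases "t = 0")
  case False
  have "\<bar>t\<bar> powr p = \<bar>t\<bar> powr (p - 2) * t\<^sup>2"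
    using False powr_add[of "\<bar>t\<bar>" "p - 2" 2] by (simp add: powr_numeral)
  then show ?thesis using False by (simp add: plog_def flog_def power2_eq_square)
qed (simp add: plog_def flog_def)

text \<open>The antiderivative of \<open>flog p\<close> that vanishes at 0. The two nonlinear sums
  of the energy combine to minus the sum of \<open>log_prim p (u x)\<close>.\<close>

definition log_prim :: "real \<Rightarrow> real \<Rightarrow> real" where
  "log_prim p t = 1 / p * plog p t - 2 / p\<^sup>2 * \<bar>t\<bar> powr p"

lemma flog_minus: "flog p (- t) = - flog p t"
  by (simp add: flog_def)

lemma log_prim_minus: "log_prim p (- t) = log_prim p t"
  by (simp add: log_prim_def plog_def)

lemma abs_flog_le:
  assumes "p > 4"
  shows "\<bar>flog p t\<bar> \<le> 2 * (\<bar>t\<bar> powr p + \<bar>t\<bar> powr (p - 2))"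
proof (cases "t = 0")
  case False
  have "\<bar>flog p t\<bar> = \<bar>\<bar>t\<bar> powr (p - 1) * ln (\<bar>t\<bar>\<^sup>2)\<bar>"
    using False powr_add[of "\<bar>t\<bar>" "p - 2" 1] by (simp add: flog_def abs_mult)
  also have "\<dots> \<le> 2 * (\<bar>t\<bar> powr (p - 1 + 1) + \<bar>t\<bar> powr (p - 1 - 1))"
    using False by (intro abs_powr_ln_le) simp
  finally show ?thesis by simp
qed (simp add: flog_def)

lemma abs_powr_le_square:
  fixes t q :: real
  assumes "\<bar>t\<bar> \<le> 1" "q \<ge> 2"
  shows "\<bar>t\<bar> powr q \<le> t\<^sup>2"
proof (cases "t = 0")
  case False
  have "\<bar>t\<bar> powr q \<le> \<bar>t\<bar> powr 2" using assms by (intro powr_mono') auto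
  also have "\<dots> = t\<^sup>2" using False by (simp add: powr_numeral)
  finally show ?thesis .
qed simp

lemma abs_flog_le_square:
  assumes p: "p > 4" and t: "\<bar>t\<bar> \<le> 1"
  shows "\<bar>flog p t\<bar> \<le> 4 * t\<^sup>2"
proof -
  have "\<bar>t\<bar> powr p \<le> t\<^sup>2" "\<bar>t\<bar> powr (p - 2) \<le> t\<^sup>2"
    using p by (auto intro!: abs_powr_le_square[OF t])
  then have "2 * (\<bar>t\<bar> powr p + \<bar>t\<bar> powr (p - 2)) \<le> 2 * (t\<^sup>2 + t\<^sup>2)"
    by (intro mult_left_mono add_mono) auto
  with abs_flog_le[OF p, of t] show ?thesis by simp
qed

lemma abs_powr_le_square_bounded:
  fixes t q R :: real
  assumes "\<bar>t\<bar> \<le> R" "q \<ge> 2"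
  shows "\<bar>t\<bar> powr q \<le> R powr (q - 2) * t\<^sup>2"
proof (cases "t = 0")
  case False
  have "\<bar>t\<bar> powr q = \<bar>t\<bar> powr (q - 2) * t\<^sup>2"
    using False powr_add[of "\<bar>t\<bar>" "q - 2" 2] by (simp add: powr_numeral)
  also have "\<dots> \<le> R powr (q - 2) * t\<^sup>2"
    using assms by (intro mult_right_mono powr_mono2) auto
  finally show ?thesis .
qed simp

text \<open>The derivative of \<open>flog p\<close>. For p > 4 the value 0 at the origin is the true
  one, since \<open>flog p\<close> is O(t^2) there.\<close>

definition flog' :: "real \<Rightarrow> real \<Rightarrow> real" where
  "flog' p t = (if t = 0 then 0 else \<bar>t\<bar> powr (p - 2) * ((p - 1) * ln (t\<^sup>2) + 2))"

text \<open>Direct for t > 0, where \<open>flog p t\<close> is t^(p-1) times 2 ln t; by oddness for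
  t < 0; by the quadratic bound at 0.\<close>

lemma has_real_derivative_flog:
  assumes "p > 4"
  shows "(flog p has_real_derivative flog' p t) (at t)"
proof -
  have pos: "(flog p has_real_derivative flog' p t) (at t)" if "t > 0" for t
  proof -
    have "((\<lambda>t. t powr (p - 1) * (2 * ln t)) has_real_derivative flog' p t) (at t)"
    proof -
      have l: "ln (t\<^sup>2) = 2 * ln t" using that by (simp add: ln_realpow)
      have d: "((\<lambda>t. t powr (p - 1)) has_real_derivative (p - 1) * t powr (p - 1 - 1)) (at t)"
        using that by (rule has_real_derivative_powr)
      have "((\<lambda>t. t powr (p - 1) * (2 * ln t)) has_real_derivative
          t powr (p - 1) * (2 * (1 / t)) + (p - 1) * t powr (p - 1 - 1) * (2 * ln t)) (at t)"
        using that by (intro DERIV_mult' d DERIV_cmult DERIV_ln_divide)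
      moreover have "t powr (p - 1) * (2 * (1 / t)) + (p - 1) * t powr (p - 1 - 1) * (2 * ln t) = flog' p t"
        using that by (simp add: flog'_def l powr_diff) (simp add: field_simps power2_eq_square)
      ultimately show ?thesis by simp
    qed
    then show ?thesis
    proof (rule has_field_derivative_transform_within_open[of _ _ _ "{0<..}"])
      fix x :: real assume "x \<in> {0<..}"
      then have x: "x > 0" by simp
      then have l: "ln (x\<^sup>2) = 2 * ln x" by (simp add: ln_realpow)
      show "x powr (p - 1) * (2 * ln x) = flog p x"
        using x by (simp add: flog_def l powr_diff) (simp add: field_simps power2_eq_square)
    qed (use that in auto)
  qed
  consider "t > 0" | "t = 0" | "t < 0" by linarith
  then show ?thesis
  proof cases
    case 2
    have "(flog p has_real_derivative 0) (at 0)"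
    proof (rule deriv_zero_if_quadratic_bound[of _ 4])
      fix t :: real assume t: "\<bar>t\<bar> \<le> 1"
      show "\<bar>flog p t\<bar> \<le> 4 * t\<^sup>2"
        using assms t by (rule abs_flog_le_square)
    qed
    then show ?thesis using 2 by (simp add: flog'_def)
  next
    case 3
    have "((\<lambda>x. - flog p (- x)) has_real_derivative - (flog' p (- t) * (- 1))) (at t)"
      by (intro DERIV_minus DERIV_chain2[OF pos]) (use 3 in \<open>auto intro!: derivative_eq_intros\<close>)
    moreover have "flog' p (- t) = flog' p t" by (simp add: flog'_def)
    ultimately show ?thesis by (simp add: flog_minus)
  qed (rule pos)
qed

lemma abs_flog'_le:
  assumes p: "p > 4" and t: "\<bar>t\<bar> \<le> M"
  shows "\<bar>flog' p t\<bar> \<le> (p - 1) * (2 * (M powr (p - 1) + M powr (p - 3))) + 2 * M powr (p - 2)"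
    (is "_ \<le> ?K")
proof (cases "t = 0")
  case True
  then show ?thesis using p by (simp add: flog'_def)
next
  case False
  have m: "\<bar>t\<bar> powr q \<le> M powr q" if "q \<ge> 0" for q
    using that t by (intro powr_mono2) auto
  have "\<bar>flog' p t\<bar> = \<bar>(p - 1) * (\<bar>t\<bar> powr (p - 2) * ln (\<bar>t\<bar>\<^sup>2)) + 2 * \<bar>t\<bar> powr (p - 2)\<bar>"
    using False by (simp add: flog'_def algebra_simps)
  also have "\<dots> \<le> (p - 1) * \<bar>\<bar>t\<bar> powr (p - 2) * ln (\<bar>t\<bar>\<^sup>2)\<bar> + 2 * \<bar>t\<bar> powr (p - 2)"
    using p by (intro order.trans[OF abs_triangle_ineq]) (simp add: abs_mult)
  also have "\<dots> \<le> (p - 1) * (2 * (\<bar>t\<bar> powr (p - 2 + 1) + \<bar>t\<bar> powr (p - 2 - 1))) + 2 * \<bar>t\<bar> powr (p - 2)"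
    using False p by (intro add_right_mono mult_left_mono abs_powr_ln_le) auto
  also have "\<dots> \<le> ?K"
    using p m[of "p - 1"] m[of "p - 3"] m[of "p - 2"]
    by (intro add_mono mult_left_mono) auto
  finally show ?thesis .
qed

text \<open>The mean value inequality with the bound on \<open>flog'\<close>. Taking y = 0 gives
  |flog p x| <= K |x|, the form behind all summability statements.\<close>

lemma flog_lipschitz:
  assumes p: "p > 4"
  obtains K where "K \<ge> 0"
    "\<And>x y. \<bar>x\<bar> \<le> M \<Longrightarrow> \<bar>y\<bar> \<le> M \<Longrightarrow> \<bar>flog p x - flog p y\<bar> \<le> K * \<bar>x - y\<bar>"
proof
  define K where "K = (p - 1) * (2 * (M powr (p - 1) + M powr (p - 3))) + 2 * M powr (p - 2)"
  show "K \<ge> 0" using p by (simp add: K_def)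
  fix x y :: real assume xy: "\<bar>x\<bar> \<le> M" "\<bar>y\<bar> \<le> M"
  have "norm (flog p x - flog p y) \<le> K * norm (x - y)"
    by (rule field_differentiable_bound[of "{-M..M}" "flog p" "flog' p"])
       (use xy abs_flog'_le[OF p] has_real_derivative_flog[OF p] in
         \<open>auto simp: K_def intro: has_field_derivative_at_within\<close>)
  then show "\<bar>flog p x - flog p y\<bar> \<le> K * \<bar>x - y\<bar>" by simp
qed

lemma has_real_derivative_log_prim:
  assumes "p > 4"
  shows "(log_prim p has_real_derivative flog p t) (at t)"
proof -
  have pos: "(log_prim p has_real_derivative flog p t) (at t)" if "t > 0" for t
  proof -
    have "((\<lambda>t. 1 / p * (t powr p * (2 * ln t)) - 2 / p\<^sup>2 * t powr p) has_real_derivative flog p t) (at t)"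
    proof -
      have l: "ln (t\<^sup>2) = 2 * ln t" using that by (simp add: ln_realpow)
      have d: "((\<lambda>t. t powr p) has_real_derivative p * t powr (p - 1)) (at t)"
        using that by (rule has_real_derivative_powr)
      have "((\<lambda>t. 1 / p * (t powr p * (2 * ln t)) - 2 / p\<^sup>2 * t powr p) has_real_derivative
          1 / p * (t powr p * (2 * (1 / t)) + p * t powr (p - 1) * (2 * ln t))
          - 2 / p\<^sup>2 * (p * t powr (p - 1))) (at t)"
        using that by (intro DERIV_diff DERIV_mult' d DERIV_cmult DERIV_ln_divide)
      moreover have "1 / p * (t powr p * (2 * (1 / t)) + p * t powr (p - 1) * (2 * ln t))
          - 2 / p\<^sup>2 * (p * t powr (p - 1)) = flog p t"
        using that assms by (simp add: flog_def l powr_diff) (simp add: field_simps power2_eq_square)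
      ultimately show ?thesis by simp
    qed
    then show ?thesis
    proof (rule has_field_derivative_transform_within_open[of _ _ _ "{0<..}"])
      fix x :: real assume "x \<in> {0<..}"
      then show "1 / p * (x powr p * (2 * ln x)) - 2 / p\<^sup>2 * x powr p = log_prim p x"
        by (simp add: log_prim_def plog_def ln_realpow)
    qed (use that in auto)
  qed
  consider "t > 0" | "t = 0" | "t < 0" by linarith
  then show ?thesis
  proof cases
    case 2
    have "(log_prim p has_real_derivative 0) (at 0)"
    proof (rule deriv_zero_if_quadratic_bound[of _ "1 / p * 4 + 2 / p\<^sup>2"])
      fix t :: real assume t: "\<bar>t\<bar> \<le> 1"
      have "\<bar>flog p t\<bar> \<le> 4 * t\<^sup>2"
        using assms t by (rule abs_flog_le_square)
      then have "\<bar>plog p t\<bar> \<le> 4 * t\<^sup>2"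
        using t mult_mono[of "\<bar>flog p t\<bar>" "4 * t\<^sup>2" "\<bar>t\<bar>" 1]
        by (simp add: plog_eq_flog_mult abs_mult)
      then have "1 / p * \<bar>plog p t\<bar> + 2 / p\<^sup>2 * \<bar>t\<bar> powr p \<le> 1 / p * (4 * t\<^sup>2) + 2 / p\<^sup>2 * t\<^sup>2"
        using abs_powr_le_square[OF t, of p] assms by (intro add_mono mult_left_mono) auto
      moreover have "\<bar>log_prim p t\<bar> \<le> \<bar>1 / p * plog p t\<bar> + \<bar>2 / p\<^sup>2 * \<bar>t\<bar> powr p\<bar>"
        unfolding log_prim_def by (rule abs_triangle_ineq4)
      ultimately show "\<bar>log_prim p t\<bar> \<le> (1 / p * 4 + 2 / p\<^sup>2) * t\<^sup>2"
        using assms by (simp add: abs_mult algebra_simps)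
    qed
    then show ?thesis using 2 by (simp add: flog_def)
  next
    case 3
    have "((\<lambda>x. log_prim p (- x)) has_real_derivative flog p (- t) * (- 1)) (at t)"
      by (intro DERIV_chain2[OF pos]) (use 3 in \<open>auto intro!: derivative_eq_intros\<close>)
    then show ?thesis by (simp add: flog_minus log_prim_minus)
  qed (rule pos)
qed

text \<open>The function \<open>log_prim p z - flog p t * z\<close> has derivative
  \<open>flog p z - flog p t\<close>, which the Lipschitz bound keeps below K |r| on the segment
  from t to t + r; the mean value inequality gives the second factor |r|.\<close>

lemma log_prim_taylor:
  assumes p: "p > 4"
    and lip: "\<And>x y. \<bar>x\<bar> \<le> M \<Longrightarrow> \<bar>y\<bar> \<le> M \<Longrightarrow> \<bar>flog p x - flog p y\<bar> \<le> K * \<bar>x - y\<bar>"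
    and K: "K \<ge> 0" and M: "\<bar>t\<bar> \<le> M" "\<bar>t + r\<bar> \<le> M"
  shows "\<bar>log_prim p (t + r) - log_prim p t - flog p t * r\<bar> \<le> K * r\<^sup>2"
proof -
  have "norm ((log_prim p (t + r) - flog p t * (t + r)) - (log_prim p t - flog p t * t))
      \<le> (K * \<bar>r\<bar>) * norm ((t + r) - t)"
  proof (rule field_differentiable_bound[of "closed_segment t (t + r)"])
    fix z assume z: "z \<in> closed_segment t (t + r)"
    then have z': "\<bar>z - t\<bar> \<le> \<bar>r\<bar>" "\<bar>z\<bar> \<le> M"
      using M by (auto simp: closed_segment_eq_real_ivl split: if_splits)
    show "((\<lambda>z. log_prim p z - flog p t * z) has_real_derivative flog p z - flog p t)
        (at z within closed_segment t (t + r))"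
      by (rule has_field_derivative_at_within)
         (auto intro!: derivative_eq_intros has_real_derivative_log_prim[OF p])
    have "\<bar>flog p z - flog p t\<bar> \<le> K * \<bar>z - t\<bar>" using z' M by (intro lip) auto
    also have "\<dots> \<le> K * \<bar>r\<bar>" using z' K by (intro mult_left_mono)
    finally show "norm (flog p z - flog p t) \<le> K * \<bar>r\<bar>" by simp
  qed auto
  then show ?thesis by (simp add: algebra_simps power2_eq_square)
qed

section \<open>The energy along a ray as a function of one variable\<close>

lemma powr_scale:
  fixes t x p :: real
  assumes "t > 0"
  shows "\<bar>t * x\<bar> powr p = t powr p * \<bar>x\<bar> powr p"
  using assms by (simp add: abs_mult powr_mult)

lemma plog_scale:
  assumes "t > 0"
  shows "plog p (t * x) = t powr p * (plog p x + 2 * ln t * \<bar>x\<bar> powr p)"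
  using assms
  by (auto simp: plog_def abs_mult powr_mult ln_mult power_mult_distrib ln_realpow algebra_simps)

lemma plog_pos_imp: "plog p t > 0 \<Longrightarrow> \<bar>t\<bar> > 1"
proof (rule ccontr)
  assume pos: "plog p t > 0" and "\<not> \<bar>t\<bar> > 1"
  then have "t\<^sup>2 \<le> 1" "t \<noteq> 0" by (auto simp: plog_def abs_square_le_1)
  then have "ln (t\<^sup>2) \<le> 0" by simp
  then show False using pos \<open>t \<noteq> 0\<close>
    by (auto simp: plog_def zero_less_mult_iff)
qed

text \<open>The data of a ray t u: A is the quadratic part, B the Kirchhoff part, P the sum of |u|^p
  and L the sum of |u|^p ln(u^2). Nothing is assumed about L, which can have either sign.\<close>

locale fibering =
  fixes A B P L p :: real
  assumes A: "A > 0" and B: "B \<ge> 0" and P: "P > 0" and p: "p > 4"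
begin

text \<open>The derivative of the energy at t u applied to t u, hence t times the derivative of
  \<open>height\<close>. Its positive zeros are the scalings that put u on the Nehari manifold. The
  term 2 P ln t comes from ln((t x)^2) = ln(x^2) + 2 ln t.\<close>

definition slope :: "real \<Rightarrow> real" where
  "slope t = A * t\<^sup>2 + B * t ^ 4 - t powr p * (L + 2 * P * ln t)"

definition height :: "real \<Rightarrow> real" where
  "height t = 1 / 2 * (A * t\<^sup>2) + 1 / 4 * (B * t ^ 4) + 2 / p\<^sup>2 * (t powr p * P)
     - 1 / p * (t powr p * (L + 2 * P * ln t))"

lemma powr_split: "t > 0 \<Longrightarrow> t powr p = t ^ 4 * t powr (p - 4)"
  using powr_add[of t 4 "p - 4"] by (simp add: powr_numeral)

lemma slope_pos_small:
  assumes "t > 0" "L + 2 * P * ln t \<le> 0"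
  shows "slope t > 0"
proof -
  have "A * t\<^sup>2 > 0" "B * t ^ 4 \<ge> 0" "t powr p * (L + 2 * P * ln t) \<le> 0"
    using A B assms by (auto simp: mult_nonneg_nonpos)
  then show ?thesis unfolding slope_def by linarith
qed

lemma continuous_on_slope: "continuous_on {0<..} slope"
  unfolding slope_def by (intro continuous_intros) auto

lemma slope_zero_below:
  assumes "T > 0" "slope T \<le> 0"
  obtains t where "0 < t" "t \<le> T" "slope t = 0"
proof -
  \<comment> \<open>The exponential is the zero of L + 2 P ln t. Up to it the logarithmic bracket is
    nonpositive, so the slope is positive at \<open>t0\<close> and changes sign before T.\<close>
  define t0 where "t0 = min T (exp (- L / (2 * P)))"
  have t0: "t0 > 0" "t0 \<le> T" using assms by (auto simp: t0_def)
  have "ln t0 \<le> - L / (2 * P)"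
    using t0(1) ln_le_cancel_iff[of t0 "exp (- L / (2 * P))"] by (simp add: t0_def)
  then have "L + 2 * P * ln t0 \<le> 0" using P by (simp add: field_simps)
  then have "slope t0 > 0" using t0 by (intro slope_pos_small)
  moreover have "continuous_on {t0..T} slope"
    by (rule continuous_on_subset[OF continuous_on_slope]) (use t0 in auto)
  ultimately obtain t where "t0 \<le> t" "t \<le> T" "slope t = 0"
    using IVT2'[of slope T 0 t0] assms t0 by auto
  then show ?thesis using t0 that[of t] by linarith
qed

lemma slope_zero_exists: obtains t where "0 < t" "slope t = 0"
proof -
  \<comment> \<open>Chosen so that the bracket L + 2 P ln T is at least A + B. As T >= 1 and p > 4,
    the term T^p (A + B) then dominates A T^2 + B T^4.\<close>
  define T where "T = exp ((A + B + \<bar>L\<bar>) / (2 * P))"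
  have T: "T \<ge> 1" using A B P by (simp add: T_def)
  have "2 * P * ln T = A + B + \<bar>L\<bar>" using P by (simp add: T_def)
  then have 1: "L + 2 * P * ln T \<ge> A + B" by linarith
  have "A * T\<^sup>2 + B * T ^ 4 \<le> A * T ^ 4 + B * T ^ 4"
    using T A by (intro add_right_mono mult_left_mono power_increasing) auto
  also have "\<dots> = T ^ 4 * (1 * (A + B))" by (simp add: algebra_simps)
  also have "\<dots> \<le> T ^ 4 * (T powr (p - 4) * (L + 2 * P * ln T))"
    using 1 A B p T by (intro mult_left_mono mult_mono ge_one_powr_ge_zero) auto
  finally have "slope T \<le> 0"
    using T unfolding slope_def by (simp add: powr_split)
  then show ?thesis using slope_zero_below[of T] T that by auto
qed

text \<open>A zero at 1 means L = A + B. For t < 1 one has t^2 >= t^4 and t^p <= t^4, so when the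
  bracket is positive the slope is at least t^4 (A + B - L - 2 P ln t) = - 2 P t^4 ln t > 0. For t >
  1 both comparisons reverse.\<close>

lemma slope_sign:
  assumes "slope 1 = 0" "t > 0"
  shows "t < 1 \<Longrightarrow> slope t > 0" and "t > 1 \<Longrightarrow> slope t < 0"
proof -
  have L: "L = A + B" using assms(1) by (simp add: slope_def)
  show "slope t > 0" if "t < 1"
  proof (cases "L + 2 * P * ln t \<le> 0")
    case True
    then show ?thesis using assms by (intro slope_pos_small)
  next
    case False
    have "t powr (p - 4) * (L + 2 * P * ln t) \<le> 1 * (L + 2 * P * ln t)"
      using False assms(2) that p by (intro mult_right_mono powr_le1) auto
    also have "\<dots> < A + B" using L that assms(2) P by (simp add: mult_pos_neg)
    finally have "t ^ 4 * (t powr (p - 4) * (L + 2 * P * ln t)) < t ^ 4 * (A + B)"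
      using assms(2) by simp
    also have "\<dots> \<le> A * t\<^sup>2 + B * t ^ 4"
      using assms(2) that A power_decreasing[of 2 4 t] by (simp add: algebra_simps)
    finally show ?thesis using assms(2) by (simp add: slope_def powr_split)
  qed
  show "slope t < 0" if "t > 1"
  proof -
    have "A * t\<^sup>2 + B * t ^ 4 \<le> t ^ 4 * (A + B)"
      using that A power_increasing[of 2 4 t] by (simp add: algebra_simps)
    also have "\<dots> < t ^ 4 * (L + 2 * P * ln t)"
      using that P L by simp
    also have "\<dots> = t ^ 4 * (1 * (L + 2 * P * ln t))" by simp
    also have "\<dots> \<le> t ^ 4 * (t powr (p - 4) * (L + 2 * P * ln t))"
      using that p A B P L by (intro mult_left_mono mult_right_mono ge_one_powr_ge_zero) auto
    finally show ?thesis using assms(2) by (simp add: slope_def powr_split)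
  qed
qed

lemma height_deriv:
  assumes "t > 0"
  shows "(height has_real_derivative slope t / t) (at t)"
  unfolding height_def slope_def using assms p
  by (auto intro!: derivative_eq_intros simp: field_simps powr_diff power2_eq_square power4_eq_xxxx
      power3_eq_cube numeral_eq_Suc)

lemma height_le:
  assumes "slope 1 = 0" "t > 0"
  shows "height t \<le> height 1"
proof (cases "t \<le> 1")
  case True
  show ?thesis
  proof (rule DERIV_nonneg_imp_nondecreasing[OF True])
    fix x assume "t \<le> x" "x \<le> 1"
    then show "\<exists>y. (height has_real_derivative y) (at x) \<and> 0 \<le> y"
      using height_deriv[of x] slope_sign(1)[OF assms(1), of x] assms
      by (intro exI[of _ "slope x / x"]) (cases "x = 1"; auto)
  qed
next
  case False
  show ?thesis
  proof (rule DERIV_nonpos_imp_nonincreasing[of 1 t])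
    fix x assume "1 \<le> x" "x \<le> t"
    then show "\<exists>y. (height has_real_derivative y) (at x) \<and> y \<le> 0"
      using height_deriv[of x] slope_sign(2)[OF assms(1), of x] assms
      by (intro exI[of _ "slope x / x"]) (cases "x = 1"; auto simp: divide_nonpos_pos)
  qed (use False in auto)
qed

end

section \<open>Ground states for an abstract Dirichlet form\<close>

definition l2 :: "('a \<Rightarrow> real) set" where
  "l2 = {u. (\<lambda>x. (u x)\<^sup>2) summable_on UNIV}"

lemma l2_mult: "u \<in> l2 \<Longrightarrow> v \<in> l2 \<Longrightarrow> (\<lambda>x. u x * v x) summable_on UNIV"
  by (rule summable_on_real_comparison[of "\<lambda>x. (u x)\<^sup>2 + (v x)\<^sup>2"])
     (auto simp: l2_def intro: summable_on_add abs_mult_le_sum_squares)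

lemma l2_add: "u \<in> l2 \<Longrightarrow> v \<in> l2 \<Longrightarrow> (\<lambda>x. u x + v x) \<in> l2"
  unfolding l2_def mem_Collect_eq
  by (rule summable_on_real_comparison[of "\<lambda>x. 2 * (u x)\<^sup>2 + 2 * (v x)\<^sup>2"])
     (auto intro: summable_on_add summable_on_cmult_right square_add_le)

lemma l2_scale: "u \<in> l2 \<Longrightarrow> (\<lambda>x. c * u x) \<in> l2"
  by (auto simp: l2_def power_mult_distrib intro: summable_on_cmult_right)

text \<open>All that the variational argument needs from the lattice: a bounded, symmetric, positive
  semidefinite form on \<open>l2\<close>, and the growth of h stated without a metric, as finiteness
  of its sublevel sets. Linearity is asked in the first argument only; symmetry carries it to the
  second.\<close>

locale log_kirchhoff =
  fixes E :: "('x::countable \<Rightarrow> real) \<Rightarrow> ('x \<Rightarrow> real) \<Rightarrow> real"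
    and h :: "'x \<Rightarrow> real" and K h0 a b p :: real
  assumes E_add: "\<And>u v z. u \<in> l2 \<Longrightarrow> v \<in> l2 \<Longrightarrow> z \<in> l2 \<Longrightarrow> E (\<lambda>x. u x + v x) z = E u z + E v z"
    and E_scale: "\<And>u v c. u \<in> l2 \<Longrightarrow> v \<in> l2 \<Longrightarrow> E (\<lambda>x. c * u x) v = c * E u v"
    and E_sym: "\<And>u v. u \<in> l2 \<Longrightarrow> v \<in> l2 \<Longrightarrow> E u v = E v u"
    and E_nonneg: "\<And>u. u \<in> l2 \<Longrightarrow> 0 \<le> E u u"
    and E_bound: "\<And>u. u \<in> l2 \<Longrightarrow> E u u \<le> K * (\<Sum>\<^sub>\<infinity>x. (u x)\<^sup>2)"
    and h0: "h0 > 0" "\<And>x. h0 \<le> h x"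
    and finite_sublevel: "\<And>M. finite {x. h x < M}"
    and a: "a > 0" and b: "b > 0" and p: "p > 4"
begin

text \<open>No condition on E appears: the lower bound on h puts these functions in
  \<open>l2\<close>, where E is bounded.\<close>

definition Hs :: "('x \<Rightarrow> real) set" where
  "Hs = {u. (\<lambda>x. h x * (u x)\<^sup>2) summable_on UNIV}"

definition pot :: "('x \<Rightarrow> real) \<Rightarrow> ('x \<Rightarrow> real) \<Rightarrow> real" where
  "pot u v = (\<Sum>\<^sub>\<infinity>x. h x * u x * v x)"

definition quad :: "('x \<Rightarrow> real) \<Rightarrow> real" where
  "quad u = a * E u u + pot u u"

definition pw :: "('x \<Rightarrow> real) \<Rightarrow> real" where
  "pw u = (\<Sum>\<^sub>\<infinity>x. \<bar>u x\<bar> powr p)"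

definition lg :: "('x \<Rightarrow> real) \<Rightarrow> real" where
  "lg u = (\<Sum>\<^sub>\<infinity>x. plog p (u x))"

definition nrg :: "('x \<Rightarrow> real) \<Rightarrow> real" where
  "nrg u = 1 / 2 * quad u + b / 4 * (E u u)\<^sup>2 + 2 / p\<^sup>2 * pw u - 1 / p * lg u"

definition dnrg :: "('x \<Rightarrow> real) \<Rightarrow> ('x \<Rightarrow> real) \<Rightarrow> real" where
  "dnrg u \<phi> = (a * E u \<phi> + pot u \<phi>) + b * E u u * E u \<phi> - (\<Sum>\<^sub>\<infinity>x. flog p (u x) * \<phi> x)"

definition nehari :: "('x \<Rightarrow> real) set" where
  "nehari = {v \<in> Hs. v \<noteq> (\<lambda>x. 0) \<and> dnrg v v = 0}"

section \<open>The weighted space and its quadratic forms\<close>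

lemma h_pos: "h x > 0"
  using h0(1) h0(2)[of x] by linarith

lemma Hs_l2: "u \<in> l2" if "u \<in> Hs"
  unfolding l2_def mem_Collect_eq
proof (rule summable_on_real_comparison)
  show "(\<lambda>x. 1 / h0 * (h x * (u x)\<^sup>2)) summable_on UNIV"
    using that unfolding Hs_def by (intro summable_on_cmult_right) auto
  show "\<bar>(u x)\<^sup>2\<bar> \<le> 1 / h0 * (h x * (u x)\<^sup>2)" for x
    using h0 mult_right_mono[OF h0(2)[of x], of "(u x)\<^sup>2"] by (simp add: field_simps)
qed

lemma Hs_mult: "(\<lambda>x. h x * u x * v x) summable_on UNIV" if "u \<in> Hs" "v \<in> Hs"
proof (rule summable_on_real_comparison)
  show "(\<lambda>x. h x * (u x)\<^sup>2 + h x * (v x)\<^sup>2) summable_on UNIV"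
    using that by (auto simp: Hs_def intro: summable_on_add)
  show "\<bar>h x * u x * v x\<bar> \<le> h x * (u x)\<^sup>2 + h x * (v x)\<^sup>2" for x
    using mult_left_mono[OF abs_mult_le_sum_squares[of "u x" "v x"], of "h x"] h_pos[of x]
    by (simp add: abs_mult algebra_simps)
qed

lemma Hs_add: "(\<lambda>x. u x + v x) \<in> Hs" if "u \<in> Hs" "v \<in> Hs"
  unfolding Hs_def mem_Collect_eq
proof (rule summable_on_real_comparison)
  show "(\<lambda>x. 2 * (h x * (u x)\<^sup>2) + 2 * (h x * (v x)\<^sup>2)) summable_on UNIV"
    using that by (auto simp: Hs_def intro: summable_on_add summable_on_cmult_right)
  show "\<bar>h x * (u x + v x)\<^sup>2\<bar> \<le> 2 * (h x * (u x)\<^sup>2) + 2 * (h x * (v x)\<^sup>2)" for x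
    using mult_left_mono[OF square_add_le[of "u x" "v x"], of "h x"] h_pos[of x]
    by (simp add: abs_mult algebra_simps)
qed

lemma Hs_scale: "(\<lambda>x. c * u x) \<in> Hs" if "u \<in> Hs"
  using summable_on_cmult_right[of "\<lambda>x. h x * (u x)\<^sup>2" UNIV "c\<^sup>2"] that
  by (simp add: Hs_def power_mult_distrib mult.left_commute)

lemma Hs_diff: "(\<lambda>x. u x - v x) \<in> Hs" if "u \<in> Hs" "v \<in> Hs"
  using Hs_add[OF that(1) Hs_scale[OF that(2), of "-1"]] by simp

lemma pot_add: "u \<in> Hs \<Longrightarrow> v \<in> Hs \<Longrightarrow> z \<in> Hs \<Longrightarrow> pot (\<lambda>x. u x + v x) z = pot u z + pot v z"
  using infsum_add[OF Hs_mult[of u z] Hs_mult[of v z]] by (simp add: pot_def algebra_simps)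

lemma pot_scale: "pot (\<lambda>x. c * u x) v = c * pot u v"
  unfolding pot_def by (simp add: mult.assoc mult.left_commute[of _ c] infsum_cmult_right')

lemma pot_sym: "pot u v = pot v u"
  by (simp add: pot_def mult_ac)

lemma pot_nonneg: "pot u u \<ge> 0"
  unfolding pot_def using h_pos by (intro infsum_nonneg) (simp add: mult.assoc less_imp_le)

lemma E_expand:
  assumes "u \<in> l2" "v \<in> l2"
  shows "E (\<lambda>x. u x + t * v x) (\<lambda>x. u x + t * v x) = E u u + 2 * t * E u v + t\<^sup>2 * E v v"
proof -
  have z: "(\<lambda>x. t * v x) \<in> l2" "(\<lambda>x. u x + t * v x) \<in> l2"
    using assms by (auto intro: l2_add l2_scale)
  have *: "E (\<lambda>x. u x + t * v x) y = E u y + t * E v y" if "y \<in> l2" for y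
    using assms that z by (simp add: E_add E_scale)
  let ?z = "\<lambda>x. u x + t * v x"
  have "E ?z ?z = E u ?z + t * E v ?z" by (rule *[OF z(2)])
  also have "E u ?z = E u u + t * E v u" using *[OF assms(1)] E_sym[OF assms(1) z(2)] by simp
  also have "E v ?z = E u v + t * E v v" using *[OF assms(2)] E_sym[OF assms(2) z(2)] by simp
  also have "E v u = E u v" using E_sym[OF assms(2,1)] .
  finally show ?thesis by (simp add: power2_eq_square algebra_simps)
qed

lemma pot_expand:
  assumes "u \<in> Hs" "v \<in> Hs"
  shows "pot (\<lambda>x. u x + t * v x) (\<lambda>x. u x + t * v x) = pot u u + 2 * t * pot u v + t\<^sup>2 * pot v v"
proof -
  have z: "(\<lambda>x. t * v x) \<in> Hs" "(\<lambda>x. u x + t * v x) \<in> Hs"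
    using assms by (auto intro: Hs_add Hs_scale)
  have *: "pot (\<lambda>x. u x + t * v x) y = pot u y + t * pot v y" if "y \<in> Hs" for y
    using assms that z by (simp add: pot_add pot_scale)
  let ?z = "\<lambda>x. u x + t * v x"
  have "pot ?z ?z = pot u ?z + t * pot v ?z" by (rule *[OF z(2)])
  also have "pot u ?z = pot u u + t * pot v u" using *[OF assms(1)] pot_sym[of u ?z] by simp
  also have "pot v ?z = pot u v + t * pot v v" using *[OF assms(2)] pot_sym[of v ?z] by simp
  also have "pot v u = pot u v" by (rule pot_sym)
  finally show ?thesis by (simp add: power2_eq_square algebra_simps)
qed

lemma E_scale2: "u \<in> l2 \<Longrightarrow> E (\<lambda>x. c * u x) (\<lambda>x. c * u x) = c\<^sup>2 * E u u"
  using l2_scale[of u c] E_scale[of u "\<lambda>x. c * u x" c] E_scale[of u u c]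
    E_sym[of u "\<lambda>x. c * u x"] by (simp add: power2_eq_square)

lemma pot_scale2: "pot (\<lambda>x. c * u x) (\<lambda>x. c * u x) = c\<^sup>2 * pot u u"
  using pot_scale[of c u "\<lambda>x. c * u x"] pot_scale[of c u u] pot_sym[of u "\<lambda>x. c * u x"]
  by (simp add: power2_eq_square)

text \<open>The polynomial t \<mapsto> E(u + t v, u + t v) is nonnegative. E is only semidefinite,
  so \<open>E v v = 0\<close> is a separate case, in which the polynomial is affine and must be
  constant.\<close>

lemma E_Cauchy_Schwarz:
  assumes "u \<in> l2" "v \<in> l2"
  shows "(E u v)\<^sup>2 \<le> E u u * E v v"
proof -
  have q: "0 \<le> E u u + 2 * t * E u v + t\<^sup>2 * E v v" for t
    using E_nonneg[of "\<lambda>x. u x + t * v x"] assms by (simp add: E_expand l2_add l2_scale)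
  show ?thesis
  proof (cases "E v v = 0")
    case True
    have "E u v = 0"
    proof (rule ccontr)
      assume "E u v \<noteq> 0"
      \<comment> \<open>At this value of t the affine function equals -1.\<close>
      then have "2 * (- (E u u + 1) / (2 * E u v)) * E u v = - (E u u + 1)" by simp
      then show False using q[of "- (E u u + 1) / (2 * E u v)"] unfolding True by linarith
    qed
    then show ?thesis using True by simp
  next
    case False
    then have "E v v > 0" using E_nonneg[OF assms(2)] by simp
    then show ?thesis using q[of "- E u v / E v v"]
      by (simp add: field_simps power2_eq_square)
  qed
qed

lemma term_le_pot:
  assumes "u \<in> Hs"
  shows "h0 * (u x)\<^sup>2 \<le> pot u u"
proof -
  have "h0 * (u x)\<^sup>2 \<le> h x * (u x)\<^sup>2" using h0 by (intro mult_right_mono) auto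
  also have "\<dots> = (\<Sum>y\<in>{x}. h y * u y * u y)" by (simp add: power2_eq_square)
  also have "\<dots> \<le> pot u u" unfolding pot_def
    using assms h_pos by (intro finite_sum_le_infsum Hs_mult) (auto simp: mult.assoc less_imp_le)
  finally show ?thesis .
qed

lemma Hs_bound:
  assumes "u \<in> Hs" "pot u u \<le> C"
  shows "\<bar>u x\<bar> \<le> sqrt (C / h0)"
proof -
  have "(u x)\<^sup>2 \<le> C / h0" using term_le_pot[OF assms(1), of x] assms(2) h0
    by (simp add: field_simps)
  then show ?thesis by (metis real_sqrt_abs real_sqrt_le_mono)
qed

lemma pot_pos:
  assumes "u \<in> Hs" "u \<noteq> (\<lambda>x. 0)"
  shows "pot u u > 0"
proof -
  obtain x where "u x \<noteq> 0" using assms(2) by auto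
  then have "h0 * (u x)\<^sup>2 > 0" using h0 by simp
  then show ?thesis using term_le_pot[OF assms(1), of x] by linarith
qed

lemma quad_pos: "u \<in> Hs \<Longrightarrow> u \<noteq> (\<lambda>x. 0) \<Longrightarrow> quad u > 0"
  unfolding quad_def using pot_pos[of u] E_nonneg[OF Hs_l2, of u] a
  by (simp add: add_nonneg_pos)

section \<open>Summability of the nonlinear terms\<close>

lemma abs_plog_le:
  obtains Kp where "Kp \<ge> 0" "\<And>t. \<bar>t\<bar> \<le> R \<Longrightarrow> \<bar>plog p t\<bar> \<le> Kp * t\<^sup>2"
proof -
  obtain Kp where Kp: "Kp \<ge> 0"
    "\<And>x y. \<bar>x\<bar> \<le> R \<Longrightarrow> \<bar>y\<bar> \<le> R \<Longrightarrow> \<bar>flog p x - flog p y\<bar> \<le> Kp * \<bar>x - y\<bar>"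
    using flog_lipschitz[OF p] by blast
  have "\<bar>plog p t\<bar> \<le> Kp * t\<^sup>2" if "\<bar>t\<bar> \<le> R" for t
  proof -
    have "\<bar>flog p t\<bar> \<le> Kp * \<bar>t\<bar>" using Kp(2)[of t 0] that by (simp add: flog_def)
    then have "\<bar>flog p t\<bar> * \<bar>t\<bar> \<le> Kp * \<bar>t\<bar> * \<bar>t\<bar>" by (intro mult_right_mono) auto
    then show ?thesis by (simp add: plog_eq_flog_mult abs_mult power2_eq_square)
  qed
  with Kp(1) show ?thesis by (rule that)
qed

text \<open>The bound on g is required only on the interval that contains all values of u, by
  \<open>Hs_bound\<close>; \<open>l2\<close> membership does the rest.\<close>

lemma summable_of_quadratic_bound:
  assumes "u \<in> Hs" "\<And>t. \<bar>t\<bar> \<le> sqrt (pot u u / h0) \<Longrightarrow> \<bar>g t\<bar> \<le> Kg * t\<^sup>2"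
  shows "(\<lambda>x. g (u x)) summable_on UNIV"
  by (rule summable_on_real_comparison[of "\<lambda>x. Kg * (u x)\<^sup>2"])
     (use Hs_l2[OF assms(1)] Hs_bound[OF assms(1) order.refl] assms(2) in
       \<open>auto simp: l2_def intro: summable_on_cmult_right\<close>)

lemma pw_summable: "u \<in> Hs \<Longrightarrow> (\<lambda>x. \<bar>u x\<bar> powr p) summable_on UNIV"
  by (rule summable_of_quadratic_bound[where g = "\<lambda>t. \<bar>t\<bar> powr p"])
     (use p in \<open>auto intro: abs_powr_le_square_bounded\<close>)

lemma lg_summable: "u \<in> Hs \<Longrightarrow> (\<lambda>x. plog p (u x)) summable_on UNIV"
  by (rule abs_plog_le[of "sqrt (pot u u / h0)"])
     (auto intro: summable_of_quadratic_bound)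

lemma flog_mult_summable:
  assumes "u \<in> Hs" "\<phi> \<in> Hs"
  shows "(\<lambda>x. flog p (u x) * \<phi> x) summable_on UNIV"
proof -
  obtain Kp where Kp: "Kp \<ge> 0"
    "\<And>x y. \<bar>x\<bar> \<le> sqrt (pot u u / h0) \<Longrightarrow> \<bar>y\<bar> \<le> sqrt (pot u u / h0) \<Longrightarrow> \<bar>flog p x - flog p y\<bar> \<le> Kp * \<bar>x - y\<bar>"
    using flog_lipschitz[OF p] by blast
  show ?thesis
  proof (rule summable_on_real_comparison)
    have "(\<lambda>x. norm (u x * \<phi> x)) summable_on UNIV"
      using l2_mult[OF Hs_l2[OF assms(1)] Hs_l2[OF assms(2)]]
      by (rule summable_on_iff_abs_summable_on_real[THEN iffD1])
    then show "(\<lambda>x. Kp * \<bar>u x * \<phi> x\<bar>) summable_on UNIV"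
      by (intro summable_on_cmult_right) simp
    show "\<bar>flog p (u x) * \<phi> x\<bar> \<le> Kp * \<bar>u x * \<phi> x\<bar>" for x
    proof -
      have "\<bar>flog p (u x)\<bar> \<le> Kp * \<bar>u x\<bar>"
        using Kp(2)[of "u x" 0] Hs_bound[OF assms(1) order.refl, of x] pot_nonneg[of u] h0
        by (simp add: flog_def)
      then show ?thesis
        using mult_right_mono[of "\<bar>flog p (u x)\<bar>" "Kp * \<bar>u x\<bar>" "\<bar>\<phi> x\<bar>"] by (simp add: abs_mult)
    qed
  qed
qed

lemma pw_pos:
  assumes "u \<in> Hs" "u \<noteq> (\<lambda>x. 0)"
  shows "pw u > 0"
proof -
  obtain x where x: "u x \<noteq> 0" using assms(2) by auto
  have "0 < (\<Sum>y\<in>{x}. \<bar>u y\<bar> powr p)" using x by simp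
  also have "\<dots> \<le> pw u" unfolding pw_def
    using assms by (intro finite_sum_le_infsum pw_summable) auto
  finally show ?thesis .
qed

section \<open>Scaling to the Nehari manifold and the energy on it\<close>

lemma dnrg_diag: "dnrg u u = quad u + b * (E u u)\<^sup>2 - lg u"
  by (simp add: dnrg_def quad_def lg_def plog_eq_flog_mult power2_eq_square)

lemma quad_scaled: "u \<in> Hs \<Longrightarrow> quad (\<lambda>x. t * u x) = quad u * t\<^sup>2"
  by (simp add: quad_def E_scale2 pot_scale2 Hs_l2 algebra_simps)

lemma pw_scaled: "t > 0 \<Longrightarrow> pw (\<lambda>x. t * u x) = t powr p * pw u"
  unfolding pw_def by (simp add: powr_scale infsum_cmult_right')

lemma lg_scaled:
  assumes "u \<in> Hs" "t > 0"
  shows "lg (\<lambda>x. t * u x) = t powr p * (lg u + 2 * pw u * ln t)"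
proof -
  have "lg (\<lambda>x. t * u x) = t powr p * (\<Sum>\<^sub>\<infinity>x. plog p (u x) + 2 * ln t * \<bar>u x\<bar> powr p)"
    unfolding lg_def using assms(2) by (simp add: plog_scale infsum_cmult_right')
  also have "(\<Sum>\<^sub>\<infinity>x. plog p (u x) + 2 * ln t * \<bar>u x\<bar> powr p) = lg u + 2 * ln t * pw u"
    unfolding lg_def pw_def using assms lg_summable pw_summable
    by (subst infsum_add) (auto simp: infsum_cmult_right' intro: summable_on_cmult_right)
  finally show ?thesis by (simp add: mult_ac)
qed

text \<open>The locale predicate has no argument for \<open>lg u\<close>, because no assumption of
  \<open>fibering\<close> mentions L; \<open>slope\<close> and \<open>height\<close> do take
  it.\<close>

lemma fibering_u:
  assumes "u \<in> Hs" "u \<noteq> (\<lambda>x. 0)"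
  shows "fibering (quad u) (b * (E u u)\<^sup>2) (pw u) p"
  using assms quad_pos pw_pos b p by unfold_locales auto

abbreviation slope_u where
  "slope_u u \<equiv> fibering.slope (quad u) (b * (E u u)\<^sup>2) (pw u) (lg u) p"

abbreviation height_u where
  "height_u u \<equiv> fibering.height (quad u) (b * (E u u)\<^sup>2) (pw u) (lg u) p"

lemma dnrg_scaled:
  assumes "u \<in> Hs" "t > 0"
  shows "dnrg (\<lambda>x. t * u x) (\<lambda>x. t * u x)
    = quad u * t\<^sup>2 + b * (E u u)\<^sup>2 * t ^ 4 - t powr p * (lg u + 2 * pw u * ln t)"
  unfolding dnrg_diag using assms
  by (simp add: quad_scaled lg_scaled E_scale2 Hs_l2 power_mult_distrib mult_ac flip: power_mult)

lemma dnrg_eq_slope: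
  assumes "u \<in> Hs" "u \<noteq> (\<lambda>x. 0)" "t > 0"
  shows "dnrg (\<lambda>x. t * u x) (\<lambda>x. t * u x) = slope_u u t"
  unfolding fibering.slope_def[OF fibering_u[OF assms(1,2)]] using assms by (simp add: dnrg_scaled)

lemma nrg_eq_height:
  assumes "u \<in> Hs" "u \<noteq> (\<lambda>x. 0)" "t > 0"
  shows "nrg (\<lambda>x. t * u x) = height_u u t"
  unfolding fibering.height_def[OF fibering_u[OF assms(1,2)]] nrg_def using assms
  by (simp add: quad_scaled lg_scaled pw_scaled E_scale2 Hs_l2 power_mult_distrib flip: power_mult)

text \<open>The constraint eliminates \<open>lg u\<close>, the only part of the energy without a
  sign; every remaining coefficient is positive for p > 4.\<close>

lemma nrg_eq_on_nehari:
  assumes "dnrg u u = 0"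
  shows "nrg u = (1 / 2 - 1 / p) * quad u + (1 / 4 - 1 / p) * (b * (E u u)\<^sup>2) + 2 / p\<^sup>2 * pw u"
proof -
  have "lg u = quad u + b * (E u u)\<^sup>2" using assms by (simp add: dnrg_diag)
  then show ?thesis by (simp add: nrg_def algebra_simps)
qed

lemma coeffs_pos: "1 / 2 - 1 / p > 0" "1 / 4 - 1 / p > 0"
  using p by (auto simp: field_simps)

lemma nehari_scale:
  assumes "u \<in> Hs" "u \<noteq> (\<lambda>x. 0)" "T > 0" "dnrg (\<lambda>x. T * u x) (\<lambda>x. T * u x) \<le> 0"
  obtains t where "0 < t" "t \<le> T" "(\<lambda>x. t * u x) \<in> nehari"
proof -
  obtain t where t: "0 < t" "t \<le> T" "slope_u u t = 0"
    using fibering.slope_zero_below[OF fibering_u[OF assms(1,2)], of T "lg u"] assms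
    by (auto simp: dnrg_eq_slope)
  then have "(\<lambda>x. t * u x) \<in> nehari"
    using assms by (auto simp: nehari_def Hs_scale dnrg_eq_slope fun_eq_iff)
  with t show ?thesis using that by blast
qed

lemma nehari_nonempty: "nehari \<noteq> {}"
proof -
  \<comment> \<open>A point mass; \<open>undefined\<close> serves as an arbitrary point of the index
    type.\<close>
  define u :: "'x \<Rightarrow> real" where "u = (\<lambda>x. if x = undefined then 1 else 0)"
  have u: "u \<noteq> (\<lambda>x. 0)" by (auto simp: u_def fun_eq_iff)
  have "u \<in> Hs" unfolding Hs_def mem_Collect_eq
    by (rule finite_nonzero_values_imp_summable_on, rule finite_subset[of _ "{undefined}"])
       (auto simp: u_def)
  then obtain t where "0 < t" "slope_u u t = 0"
    using fibering.slope_zero_exists[OF fibering_u[OF _ u]] by blast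
  then have "(\<lambda>x. t * u x) \<in> nehari"
    using \<open>u \<in> Hs\<close> u by (auto simp: nehari_def Hs_scale dnrg_eq_slope fun_eq_iff)
  then show ?thesis by blast
qed

lemma nehari_pot_le:
  assumes "u \<in> nehari"
  shows "(1 / 2 - 1 / p) * pot u u \<le> nrg u"
proof -
  have u: "u \<in> Hs" "dnrg u u = 0" using assms by (auto simp: nehari_def)
  have "(1 / 2 - 1 / p) * pot u u \<le> (1 / 2 - 1 / p) * quad u"
    using coeffs_pos E_nonneg[OF Hs_l2[OF u(1)]] a by (intro mult_left_mono) (auto simp: quad_def)
  moreover have "(1 / 4 - 1 / p) * (b * (E u u)\<^sup>2) \<ge> 0" using coeffs_pos b by simp
  moreover have "2 / p\<^sup>2 * pw u \<ge> 0" by (simp add: pw_def infsum_nonneg)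
  ultimately show ?thesis unfolding nrg_eq_on_nehari[OF u(2)] by linarith
qed

lemma nehari_nrg_nonneg: "u \<in> nehari \<Longrightarrow> nrg u \<ge> 0"
  using nehari_pot_le[of u] pot_nonneg[of u] coeffs_pos
  by (meson less_imp_le mult_nonneg_nonneg order.trans)

section \<open>Compactness under a bound on the potential energy\<close>

lemma pot_Fatou:
  assumes "\<And>n. v n \<in> Hs" "\<And>n. pot (v n) (v n) \<le> c n" "c \<longlonglongrightarrow> C"
    and "\<And>x. (\<lambda>n. v n x) \<longlonglongrightarrow> u x"
  shows "u \<in> Hs" "pot u u \<le> C"
proof -
  \<comment> \<open>Finite sums pass to the pointwise limit. The bounds \<open>c n\<close> may vary,
    so that \<open>c n\<close> can later be \<open>pot (v n) (v n)\<close> itself, with its limit as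
    C.\<close>
  have fin: "(\<Sum>x\<in>F. h x * (u x)\<^sup>2) \<le> C" if "finite F" for F
  proof (rule LIMSEQ_le)
    show "(\<lambda>n. \<Sum>x\<in>F. h x * (v n x)\<^sup>2) \<longlonglongrightarrow> (\<Sum>x\<in>F. h x * (u x)\<^sup>2)"
      by (intro tendsto_intros assms)
    show "c \<longlonglongrightarrow> C" by fact
    have "(\<Sum>x\<in>F. h x * (v n x)\<^sup>2) \<le> c n" for n
    proof -
      have "(\<Sum>x\<in>F. h x * v n x * v n x) \<le> pot (v n) (v n)"
        unfolding pot_def using assms(1)[of n] that h_pos
        by (intro finite_sum_le_infsum Hs_mult) (auto simp: mult.assoc less_imp_le)
      then show ?thesis using assms(2)[of n] by (simp add: power2_eq_square mult.assoc)
    qed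
    then show "\<exists>N. \<forall>n\<ge>N. (\<Sum>x\<in>F. h x * (v n x)\<^sup>2) \<le> c n" by blast
  qed
  have "(\<lambda>x. h x * (u x)\<^sup>2) summable_on UNIV"
    using fin h_pos by (intro nonneg_bdd_above_summable_on) (auto simp: bdd_above_def less_imp_le)
  then show "u \<in> Hs" by (simp add: Hs_def)
  have "(\<Sum>\<^sub>\<infinity>x. h x * (u x)\<^sup>2) \<le> C"
    using fin \<open>(\<lambda>x. h x * (u x)\<^sup>2) summable_on UNIV\<close> by (intro infsum_le_finite_sums) auto
  then show "pot u u \<le> C" by (simp add: pot_def power2_eq_square mult.assoc)
qed

text \<open>Where \<open>h \<ge> M\<close> the terms contribute at most \<open>2 Kg C / M\<close>, uniformly along the sequence,
  and only finitely many points remain.\<close>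

lemma sum_tendsto_of_quadratic_bound:
  assumes v: "\<And>n. v n \<in> Hs" "\<And>n. pot (v n) (v n) \<le> C"
    and lim: "\<And>x. (\<lambda>n. v n x) \<longlonglongrightarrow> u x"
    and g: "\<And>t. isCont g t" "\<And>t. \<bar>t\<bar> \<le> sqrt (C / h0) \<Longrightarrow> \<bar>g t\<bar> \<le> Kg * t\<^sup>2"
  shows "(\<lambda>n. \<Sum>\<^sub>\<infinity>x. g (v n x)) \<longlonglongrightarrow> (\<Sum>\<^sub>\<infinity>x. g (u x))"
proof -
  have u: "u \<in> Hs" "pot u u \<le> C"
    using pot_Fatou[of v "\<lambda>_. C" C u] v lim by auto
  have C: "C \<ge> 0" using pot_nonneg[of u] u by linarith
  have gb: "\<bar>g (z x)\<bar> \<le> Kg * (z x)\<^sup>2" if "z \<in> Hs" "pot z z \<le> C" for z x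
    using Hs_bound[OF that] by (rule g(2))
  have gs: "(\<lambda>x. g (z x)) summable_on UNIV" if "z \<in> Hs" "pot z z \<le> C" for z
    by (rule summable_on_real_comparison[of "\<lambda>x. Kg * (z x)\<^sup>2"])
       (use gb[OF that] Hs_l2[OF that(1)] in \<open>auto simp: l2_def intro: summable_on_cmult_right\<close>)
  \<comment> \<open>No sign of \<open>Kg\<close> is assumed, but the estimates multiply inequalities
    by the constant.\<close>
  define kg where "kg = max Kg 0"
  have kg: "kg \<ge> 0" by (simp add: kg_def)
  have gk: "\<bar>g (z x)\<bar> \<le> kg * (z x)\<^sup>2" if "z \<in> Hs" "pot z z \<le> C" for z x
    using gb[OF that, of x] mult_right_mono[of Kg kg "(z x)\<^sup>2"] by (simp add: kg_def)
  show ?thesis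
  proof (rule LIMSEQ_I)
    fix r :: real assume r: "r > 0"
    \<comment> \<open>Makes the tail 2 kg C / M smaller than r / 2; the summand 1 gives strictness
      and keeps M positive when kg or C is 0.\<close>
    define M where "M = 4 * kg * C / r + 1"
    have M: "M > 0" using kg C r by (simp add: M_def add_nonneg_pos)
    define F where "F = {x. h x < M}"
    have F: "finite F" unfolding F_def by (rule finite_sublevel)
    have small: "kg / M * (2 * C) < r / 2"
      using M r by (simp add: field_simps) (simp add: M_def field_simps)
    have bound: "\<bar>(\<Sum>\<^sub>\<infinity>x. g (v n x)) - (\<Sum>\<^sub>\<infinity>x. g (u x))\<bar>
        \<le> (\<Sum>x\<in>F. \<bar>g (v n x) - g (u x)\<bar>) + kg / M * (2 * C)" for n
    proof -
      let ?d = "\<lambda>x. if x \<in> F then \<bar>g (v n x) - g (u x)\<bar> else 0"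
      \<comment> \<open>Off F the factor h / M is at least 1, so this dominates kg (v^2 + u^2). It
        is nonnegative everywhere and can be added on F as well.\<close>
      let ?e = "\<lambda>x. kg / M * (h x * v n x * v n x + h x * u x * u x)"
      have d: "?d summable_on UNIV" "infsum ?d UNIV = (\<Sum>x\<in>F. \<bar>g (v n x) - g (u x)\<bar>)"
        using F summable_on_cong_neutral[of UNIV F ?d "\<lambda>x. \<bar>g (v n x) - g (u x)\<bar>"]
          infsum_cong_neutral[of UNIV F ?d "\<lambda>x. \<bar>g (v n x) - g (u x)\<bar>"] by auto
      have hh: "(\<lambda>x. h x * v n x * v n x + h x * u x * u x) summable_on UNIV"
        using u v by (intro summable_on_add Hs_mult) auto
      have "infsum ?e UNIV = kg / M * (pot (v n) (v n) + pot u u)"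
        unfolding pot_def using u v
        by (simp only: infsum_add[OF Hs_mult Hs_mult, symmetric] infsum_cmult_right')
      also have "\<dots> \<le> kg / M * (2 * C)"
        using u(2) v(2)[of n] kg M by (intro mult_left_mono) auto
      finally have e: "infsum ?e UNIV \<le> kg / M * (2 * C)" .
      have es: "?e summable_on UNIV" by (intro summable_on_cmult_right hh)
      have pt: "\<bar>g (v n x) - g (u x)\<bar> \<le> ?d x + ?e x" for x
      proof (cases "x \<in> F")
        case True
        have "?e x \<ge> 0" using kg M h_pos[of x] by (simp add: mult.assoc)
        then show ?thesis using True by simp
      next
        case False
        then have hM: "1 \<le> h x / M" using M by (simp add: F_def)
        have 1: "kg * y\<^sup>2 \<le> kg / M * (h x * y * y)" for y
          using mult_left_mono[OF hM, of "kg * y\<^sup>2"] kg by (simp add: power2_eq_square mult_ac)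
        have "\<bar>g (v n x) - g (u x)\<bar> \<le> \<bar>g (v n x)\<bar> + \<bar>g (u x)\<bar>" by (rule abs_triangle_ineq4)
        also have "\<dots> \<le> kg * (v n x)\<^sup>2 + kg * (u x)\<^sup>2" by (intro add_mono gk u v)
        also have "\<dots> \<le> ?e x" using 1[of "v n x"] 1[of "u x"] by (simp only: distrib_left)
        finally show ?thesis using False by simp
      qed
      have "\<bar>(\<Sum>\<^sub>\<infinity>x. g (v n x)) - (\<Sum>\<^sub>\<infinity>x. g (u x))\<bar> = \<bar>\<Sum>\<^sub>\<infinity>x. g (v n x) - g (u x)\<bar>"
        by (simp add: infsum_diff_real gs u v)
      also have "\<dots> \<le> (\<Sum>\<^sub>\<infinity>x. ?d x + ?e x)"
        using pt by (intro abs_infsum_le summable_on_add[OF d(1) es])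
      also have "\<dots> = infsum ?d UNIV + infsum ?e UNIV" by (rule infsum_add[OF d(1) es])
      finally show ?thesis using d(2) e by linarith
    qed
    have "(\<lambda>n. \<Sum>x\<in>F. \<bar>g (v n x) - g (u x)\<bar>) \<longlonglongrightarrow> (\<Sum>x\<in>F. \<bar>g (u x) - g (u x)\<bar>)"
      by (intro tendsto_intros isCont_tendsto_compose[OF g(1)] lim)
    then have "\<forall>\<^sub>F n in sequentially. (\<Sum>x\<in>F. \<bar>g (v n x) - g (u x)\<bar>) < r / 2"
      using r by (intro order_tendstoD(2)[where y = "\<Sum>x\<in>F. \<bar>g (u x) - g (u x)\<bar>"]) auto
    then obtain N where N: "\<And>n. n \<ge> N \<Longrightarrow> (\<Sum>x\<in>F. \<bar>g (v n x) - g (u x)\<bar>) < r / 2"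
      by (auto simp: eventually_sequentially)
    have "norm ((\<Sum>\<^sub>\<infinity>x. g (v n x)) - (\<Sum>\<^sub>\<infinity>x. g (u x))) < r" if "n \<ge> N" for n
      using bound[of n] N[OF that] small by simp
    then show "\<exists>N. \<forall>n\<ge>N. norm ((\<Sum>\<^sub>\<infinity>x. g (v n x)) - (\<Sum>\<^sub>\<infinity>x. g (u x))) < r" by blast
  qed
qed

lemma isCont_plog: "isCont (plog p) t"
proof -
  have "isCont (\<lambda>t. flog p t * t) t"
    using DERIV_isCont[OF has_real_derivative_flog[OF p, of t]] by (intro continuous_intros)
  then show ?thesis by (simp add: plog_eq_flog_mult[abs_def])
qed

lemma pw_lg_tendsto:
  assumes v: "\<And>n. v n \<in> Hs" "\<And>n. pot (v n) (v n) \<le> C"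
    and lim: "\<And>x. (\<lambda>n. v n x) \<longlonglongrightarrow> u x"
  shows "(\<lambda>n. pw (v n)) \<longlonglongrightarrow> pw u" "(\<lambda>n. lg (v n)) \<longlonglongrightarrow> lg u"
proof -
  show "(\<lambda>n. pw (v n)) \<longlonglongrightarrow> pw u"
    unfolding pw_def
    by (rule sum_tendsto_of_quadratic_bound[OF v lim, where Kg = "sqrt (C / h0) powr (p - 2)"])
       (use p in \<open>auto intro!: continuous_intros abs_powr_le_square_bounded\<close>)
  obtain Kp where "\<And>t. \<bar>t\<bar> \<le> sqrt (C / h0) \<Longrightarrow> \<bar>plog p t\<bar> \<le> Kp * t\<^sup>2"
    using abs_plog_le by blast
  then show "(\<lambda>n. lg (v n)) \<longlonglongrightarrow> lg u"
    unfolding lg_def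
    by (intro sum_tendsto_of_quadratic_bound[OF v lim, where Kg = Kp] isCont_plog)
qed

text \<open>The compact embedding of \<open>Hs\<close> into \<open>l2\<close>: the preceding
  convergence result applied to the differences with g(t) = t^2. Their potential energy is at most 4
  C.\<close>

lemma square_sum_tendsto:
  assumes v: "\<And>n. v n \<in> Hs" "\<And>n. pot (v n) (v n) \<le> C"
    and lim: "\<And>x. (\<lambda>n. v n x) \<longlonglongrightarrow> u x"
  shows "(\<lambda>n. \<Sum>\<^sub>\<infinity>x. (v n x - u x)\<^sup>2) \<longlonglongrightarrow> 0"
proof -
  have u: "u \<in> Hs" "pot u u \<le> C"
    using pot_Fatou[of v "\<lambda>_. C" C u] v lim by auto
  have d: "(\<lambda>x. v n x - u x) \<in> Hs" for n using v u by (intro Hs_diff)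
  have pd: "pot (\<lambda>x. v n x - u x) (\<lambda>x. v n x - u x) \<le> 4 * C" for n
  proof -
    have "pot (\<lambda>x. v n x - u x) (\<lambda>x. v n x - u x)
        \<le> (\<Sum>\<^sub>\<infinity>x. 2 * (h x * v n x * v n x) + 2 * (h x * u x * u x))"
      unfolding pot_def
    proof (rule infsum_mono)
      show "(\<lambda>x. h x * (v n x - u x) * (v n x - u x)) summable_on UNIV" using Hs_mult[OF d d] .
      show "(\<lambda>x. 2 * (h x * v n x * v n x) + 2 * (h x * u x * u x)) summable_on UNIV"
        using u v by (intro summable_on_add summable_on_cmult_right Hs_mult)
      show "h x * (v n x - u x) * (v n x - u x) \<le> 2 * (h x * v n x * v n x) + 2 * (h x * u x * u x)" for x
        using mult_left_mono[OF square_diff_le[of "v n x" "u x"], of "h x"] h_pos[of x]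
        by (simp add: power2_eq_square algebra_simps)
    qed
    also have "\<dots> = 2 * pot (v n) (v n) + 2 * pot u u"
      unfolding pot_def using u v
      by (simp only: infsum_add[OF summable_on_cmult_right[OF Hs_mult] summable_on_cmult_right[OF Hs_mult]]
          infsum_cmult_right')
    finally show ?thesis using u(2) v(2)[of n] by linarith
  qed
  have "(\<lambda>n. \<Sum>\<^sub>\<infinity>x. (v n x - u x)\<^sup>2) \<longlonglongrightarrow> (\<Sum>\<^sub>\<infinity>x::'x. 0\<^sup>2)"
  proof (rule sum_tendsto_of_quadratic_bound[OF d pd, where g = "\<lambda>t. t\<^sup>2" and Kg = 1])
    show "(\<lambda>n. v n x - u x) \<longlonglongrightarrow> 0" for x
      using tendsto_diff[OF lim[of x] tendsto_const[of "u x"]] by simp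
  qed auto
  then show ?thesis by simp
qed

text \<open>With d = v - u, expand E(u + d, u + d): \<open>E_bound\<close> sends E(d, d) to 0, and
  Cauchy-Schwarz then does the same for E(u, d).\<close>

lemma E_tendsto:
  assumes v: "\<And>n. v n \<in> l2" "u \<in> l2"
    and lim: "(\<lambda>n. \<Sum>\<^sub>\<infinity>x. (v n x - u x)\<^sup>2) \<longlonglongrightarrow> 0"
  shows "(\<lambda>n. E (v n) (v n)) \<longlonglongrightarrow> E u u"
proof -
  define d where "d n = (\<lambda>x. v n x - u x)" for n
  have d: "d n \<in> l2" for n
    using l2_add[OF v(1)[of n] l2_scale[OF v(2), of "-1"]] by (simp add: d_def)
  have Ed: "(\<lambda>n. E (d n) (d n)) \<longlonglongrightarrow> 0"
  proof (rule tendsto_sandwich)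
    show "\<forall>\<^sub>F n in sequentially. 0 \<le> E (d n) (d n)" using E_nonneg d by simp
    show "\<forall>\<^sub>F n in sequentially. E (d n) (d n) \<le> K * (\<Sum>\<^sub>\<infinity>x. (d n x)\<^sup>2)" using E_bound d by simp
    show "(\<lambda>n. K * (\<Sum>\<^sub>\<infinity>x. (d n x)\<^sup>2)) \<longlonglongrightarrow> 0"
      using tendsto_mult[OF tendsto_const[of K] lim] by (simp add: d_def)
  qed simp
  have "(\<lambda>n. (E u (d n))\<^sup>2) \<longlonglongrightarrow> 0"
  proof (rule tendsto_sandwich)
    show "\<forall>\<^sub>F n in sequentially. 0 \<le> (E u (d n))\<^sup>2" by simp
    show "\<forall>\<^sub>F n in sequentially. (E u (d n))\<^sup>2 \<le> E u u * E (d n) (d n)"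
      using E_Cauchy_Schwarz d v by simp
    show "(\<lambda>n. E u u * E (d n) (d n)) \<longlonglongrightarrow> 0"
      using tendsto_mult[OF tendsto_const[of "E u u"] Ed] by simp
  qed simp
  then have Eud: "(\<lambda>n. E u (d n)) \<longlonglongrightarrow> 0"
    using tendsto_real_sqrt[of "\<lambda>n. (E u (d n))\<^sup>2" 0] by (simp add: tendsto_rabs_zero_iff)
  have "E (v n) (v n) = E u u + 2 * E u (d n) + E (d n) (d n)" for n
    using E_expand[OF v(2) d, of 1 n] by (simp add: d_def)
  moreover have "(\<lambda>n. E u u + 2 * E u (d n) + E (d n) (d n)) \<longlonglongrightarrow> E u u + 2 * 0 + 0"
    by (intro tendsto_intros Eud Ed)
  ultimately show ?thesis by simp
qed


section \<open>Existence of a minimizer on the Nehari manifold\<close>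

lemma nehari_sum_squares_gt:
  assumes "u \<in> nehari"
  shows "(\<Sum>\<^sub>\<infinity>x. (u x)\<^sup>2) > 1"
proof -
  have u: "u \<in> Hs" "u \<noteq> (\<lambda>x. 0)" "dnrg u u = 0" using assms by (auto simp: nehari_def)
  have "b * (E u u)\<^sup>2 \<ge> 0" using b by simp
  \<comment> \<open>The constraint equates \<open>lg u\<close> with a positive quantity, so some
    term of the sum is positive. The resulting lower bound is the same for the whole manifold and
    survives \<open>l2\<close> limits.\<close>
  then have "lg u > 0" using quad_pos[OF u(1,2)] u(3) by (simp add: dnrg_diag)
  have "\<exists>x. plog p (u x) > 0"
  proof (rule ccontr)
    assume "\<nexists>x. plog p (u x) > 0"
    then have "lg u \<le> (\<Sum>\<^sub>\<infinity>x::'x. 0)"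
      unfolding lg_def using lg_summable[OF u(1)] by (intro infsum_mono) (auto simp: not_less)
    with \<open>lg u > 0\<close> show False by simp
  qed
  then obtain x where "\<bar>u x\<bar> > 1" using plog_pos_imp by blast
  then have "1 < (u x)\<^sup>2" using one_less_power[of "\<bar>u x\<bar>" 2] by simp
  also have "\<dots> = (\<Sum>y\<in>{x}. (u y)\<^sup>2)" by simp
  also have "\<dots> \<le> (\<Sum>\<^sub>\<infinity>x. (u x)\<^sup>2)"
    using Hs_l2[OF u(1)] by (intro finite_sum_le_infsum) (auto simp: l2_def)
  finally show ?thesis .
qed

lemma minimizer_exists:
  obtains u where "u \<in> nehari" "\<And>v. v \<in> nehari \<Longrightarrow> nrg u \<le> nrg v"
proof -
  define m where "m = Inf (nrg ` nehari)"
  have bdd: "bdd_below (nrg ` nehari)" using nehari_nrg_nonneg by (auto simp: bdd_below_def)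
  have m_le: "m \<le> nrg v" if "v \<in> nehari" for v
    unfolding m_def using that bdd by (intro cInf_lower) auto
  have "\<exists>v\<in>nehari. nrg v < m + 1 / real (Suc n)" for n
    using cInf_lessD[of "nrg ` nehari" "m + 1 / real (Suc n)"] nehari_nonempty
    by (auto simp: m_def)
  then obtain v where v: "\<And>n. v n \<in> nehari" "\<And>n. nrg (v n) < m + 1 / real (Suc n)"
    by metis
  have "(\<lambda>n. 1 / real (Suc n)) \<longlonglongrightarrow> 0" using LIMSEQ_inverse_real_of_nat by (simp add: inverse_eq_divide)
  then have "(\<lambda>n. m + 1 / real (Suc n)) \<longlonglongrightarrow> m + 0" by (intro tendsto_intros)
  then have lim_m: "(\<lambda>n. m + 1 / real (Suc n)) \<longlonglongrightarrow> m" by simp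
  have vm: "(\<lambda>n. nrg (v n)) \<longlonglongrightarrow> m"
  proof (rule tendsto_sandwich[OF _ _ tendsto_const lim_m])
    show "\<forall>\<^sub>F n in sequentially. m \<le> nrg (v n)"
      using m_le[OF v(1)] by (rule always_eventually[OF allI])
    show "\<forall>\<^sub>F n in sequentially. nrg (v n) \<le> m + 1 / real (Suc n)"
      using less_imp_le[OF v(2)] by (rule always_eventually[OF allI])
  qed
  \<comment> \<open>From \<open>nehari_pot_le\<close>, because the energies along the sequence stay
    below m + 1.\<close>
  define C where "C = (m + 1) / (1 / 2 - 1 / p)"
  have vC: "pot (v n) (v n) \<le> C" for n
  proof -
    have "(1 / 2 - 1 / p) * pot (v n) (v n) \<le> m + 1 / real (Suc n)"
      using nehari_pot_le[OF v(1)[of n]] v(2)[of n] by linarith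
    also have "\<dots> \<le> m + 1" by simp
    finally show ?thesis unfolding C_def pos_le_divide_eq[OF coeffs_pos(1)]
      by (simp add: mult.commute)
  qed
  have vH: "v n \<in> Hs" and vd: "dnrg (v n) (v n) = 0" for n using v(1)[of n] by (auto simp: nehari_def)
  obtain u r where r: "strict_mono (r :: nat \<Rightarrow> nat)" and lim: "\<And>x. (\<lambda>n. v (r n) x) \<longlonglongrightarrow> u x"
    by (rule bounded_pointwise_convergent_subseq[of v "sqrt (C / h0)"])
       (use Hs_bound[OF vH vC] in auto)
  have u: "u \<in> Hs"
    using pot_Fatou(1)[of "\<lambda>n. v (r n)" "\<lambda>_. C" C u] vH vC lim by auto
  note conv = pw_lg_tendsto[of "\<lambda>n. v (r n)", OF vH vC lim]
  note sq = square_sum_tendsto[of "\<lambda>n. v (r n)", OF vH vC lim]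
  have Ec: "(\<lambda>n. E (v (r n)) (v (r n))) \<longlonglongrightarrow> E u u"
    by (rule E_tendsto[OF _ _ sq]) (use u vH Hs_l2 in auto)
  have u0: "u \<noteq> (\<lambda>x. 0)"
  proof
    assume "u = (\<lambda>x. 0)"
    then have "(\<lambda>n. \<Sum>\<^sub>\<infinity>x. (v (r n) x)\<^sup>2) \<longlonglongrightarrow> 0" using sq by simp
    moreover have "1 \<le> (\<Sum>\<^sub>\<infinity>x. (v (r n) x)\<^sup>2)" for n
      using nehari_sum_squares_gt[OF v(1)] by (simp add: less_imp_le)
    ultimately have "(1::real) \<le> 0" by (intro LIMSEQ_le_const) auto
    then show False by simp
  qed
  \<comment> \<open>The limit of \<open>pot (v (r n)) (v (r n))\<close>, found by solving the
    constraint for \<open>pot\<close>; all other terms of the constraint converge to their values at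
    u. Lower semicontinuity gives only \<open>pot u u \<le> \<sigma>\<close>.\<close>
  define \<sigma> where "\<sigma> = lg u - b * (E u u)\<^sup>2 - a * E u u"
  have pot_eq: "pot (v n) (v n) = lg (v n) - b * (E (v n) (v n))\<^sup>2 - a * E (v n) (v n)" for n
    using vd[of n] by (simp add: dnrg_diag quad_def)
  have pc: "(\<lambda>n. pot (v (r n)) (v (r n))) \<longlonglongrightarrow> \<sigma>"
    unfolding pot_eq \<sigma>_def by (intro tendsto_intros conv Ec)
  have pu: "pot u u \<le> \<sigma>"
    using pot_Fatou(2)[of "\<lambda>n. v (r n)", OF vH order.refl pc lim] .
  have "(\<lambda>n. nrg (v (r n))) \<longlonglongrightarrow> m"
    using LIMSEQ_subseq_LIMSEQ[OF vm r] by (simp add: o_def)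
  moreover have "(\<lambda>n. nrg (v (r n))) \<longlonglongrightarrow>
      (1 / 2 - 1 / p) * (a * E u u + \<sigma>) + (1 / 4 - 1 / p) * (b * (E u u)\<^sup>2) + 2 / p\<^sup>2 * pw u"
    unfolding nrg_eq_on_nehari[OF vd] quad_def by (intro tendsto_intros conv Ec pc)
  ultimately have m: "m = (1 / 2 - 1 / p) * (a * E u u + \<sigma>) + (1 / 4 - 1 / p) * (b * (E u u)\<^sup>2) + 2 / p\<^sup>2 * pw u"
    by (rule LIMSEQ_unique)
  \<comment> \<open>By the choice of \<sigma>, \<open>dnrg u u\<close> equals
    \<open>pot u u - \<sigma>\<close>. The factor 1 matches the shape of \<open>nehari_scale\<close>
    with T = 1.\<close>
  have "dnrg (\<lambda>x. 1 * u x) (\<lambda>x. 1 * u x) \<le> 0" using pu by (simp add: dnrg_diag quad_def \<sigma>_def)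
  then obtain t where t: "0 < t" "t \<le> 1" "(\<lambda>x. t * u x) \<in> nehari"
    using nehari_scale[OF u u0, of 1] by auto
  have dt: "dnrg (\<lambda>x. t * u x) (\<lambda>x. t * u x) = 0" using t(3) by (simp add: nehari_def)
  have "nrg (\<lambda>x. t * u x) = (1 / 2 - 1 / p) * (quad u * t\<^sup>2) + (1 / 4 - 1 / p) * (b * (E u u)\<^sup>2 * t ^ 4)
      + 2 / p\<^sup>2 * (t powr p * pw u)"
    unfolding nrg_eq_on_nehari[OF dt] using u t(1)
    by (simp add: quad_scaled pw_scaled E_scale2 Hs_l2 power_mult_distrib mult_ac flip: power_mult)
  also have "\<dots> \<le> (1 / 2 - 1 / p) * (quad u * 1) + (1 / 4 - 1 / p) * (b * (E u u)\<^sup>2 * 1)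
      + 2 / p\<^sup>2 * (1 * pw u)"
    using t coeffs_pos quad_pos[OF u u0] pw_pos[OF u u0] b p
    by (intro add_mono mult_left_mono mult_right_mono power_le_one powr_le1) auto
  \<comment> \<open>m is the same expression with \<sigma> in place of
    \<open>pot u u\<close>.\<close>
  also have "\<dots> \<le> m"
    unfolding m using pu coeffs_pos by (simp add: quad_def)
  finally show ?thesis using that[OF t(3)] m_le order.trans by blast
qed

section \<open>A minimizer is a critical point\<close>

lemma dnrg_uminus:
  assumes "u \<in> Hs" "\<phi> \<in> Hs"
  shows "dnrg u (\<lambda>x. - \<phi> x) = - dnrg u \<phi>"
proof -
  have "E u (\<lambda>x. - \<phi> x) = - E u \<phi>"
    using E_scale[OF Hs_l2 Hs_l2, OF assms(2,1), of "-1"] E_sym[OF Hs_l2 Hs_l2, OF assms]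
      E_sym[OF Hs_l2[OF assms(1)] l2_scale[OF Hs_l2[OF assms(2)], of "-1"]] by simp
  moreover have "pot u (\<lambda>x. - \<phi> x) = - pot u \<phi>"
    by (simp add: pot_def infsum_uminus)
  ultimately show ?thesis
    by (simp add: dnrg_def infsum_uminus)
qed

text \<open>Everything except the nonlinear sum is polynomial in t. That sum is Lipschitz at t = 1,
  with the \<open>flog\<close> constant for the range 2R, which contains all values t u(x) with 0 <=
  t <= 2.\<close>

lemma dnrg_ray_continuous:
  assumes u: "u \<in> Hs" and f: "\<phi> \<in> Hs"
  shows "((\<lambda>t. dnrg (\<lambda>x. t * u x) \<phi>) \<longlongrightarrow> dnrg u \<phi>) (at 1)"
proof -
  define R where "R = sqrt (pot u u / h0)"
  have uR: "\<bar>u x\<bar> \<le> R" for x unfolding R_def by (rule Hs_bound[OF u order.refl])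
  obtain Kp where Kp: "Kp \<ge> 0"
    "\<And>x y. \<bar>x\<bar> \<le> 2 * R \<Longrightarrow> \<bar>y\<bar> \<le> 2 * R \<Longrightarrow> \<bar>flog p x - flog p y\<bar> \<le> Kp * \<bar>x - y\<bar>"
    using flog_lipschitz[OF p] by blast
  define N where "N t = (\<Sum>\<^sub>\<infinity>x. flog p (t * u x) * \<phi> x)" for t
  define S where "S = (\<Sum>\<^sub>\<infinity>x. \<bar>u x * \<phi> x\<bar>)"
  have us: "(\<lambda>x. \<bar>u x * \<phi> x\<bar>) summable_on UNIV"
    using l2_mult[OF Hs_l2[OF u] Hs_l2[OF f]]
      summable_on_iff_abs_summable_on_real[of "\<lambda>x. u x * \<phi> x" UNIV] by simp
  have Nb: "\<bar>N t - N 1\<bar> \<le> Kp * \<bar>t - 1\<bar> * S" if "0 \<le> t" "t \<le> 2" for t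
  proof -
    have "N t - N 1 = (\<Sum>\<^sub>\<infinity>x. flog p (t * u x) * \<phi> x - flog p (1 * u x) * \<phi> x)"
      unfolding N_def by (rule infsum_diff_real[symmetric]; intro flog_mult_summable Hs_scale u f)
    also have "\<bar>\<dots>\<bar> \<le> (\<Sum>\<^sub>\<infinity>x. Kp * \<bar>t - 1\<bar> * \<bar>u x * \<phi> x\<bar>)"
    proof (rule abs_infsum_le)
      show "(\<lambda>x. Kp * \<bar>t - 1\<bar> * \<bar>u x * \<phi> x\<bar>) summable_on UNIV" by (intro summable_on_cmult_right us)
      fix x
      have "\<bar>t * u x\<bar> \<le> 2 * R" "\<bar>u x\<bar> \<le> 2 * R"
        using mult_mono[of "\<bar>t\<bar>" 2 "\<bar>u x\<bar>" R] uR[of x] that by (auto simp: abs_mult)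
      then have "\<bar>flog p (t * u x) - flog p (u x)\<bar> \<le> Kp * \<bar>t * u x - u x\<bar>" by (rule Kp(2))
      also have "\<bar>t * u x - u x\<bar> = \<bar>t - 1\<bar> * \<bar>u x\<bar>" by (simp add: abs_mult[symmetric] algebra_simps)
      finally have "\<bar>flog p (t * u x) - flog p (u x)\<bar> * \<bar>\<phi> x\<bar> \<le> Kp * (\<bar>t - 1\<bar> * \<bar>u x\<bar>) * \<bar>\<phi> x\<bar>"
        by (intro mult_right_mono) auto
      then show "\<bar>flog p (t * u x) * \<phi> x - flog p (1 * u x) * \<phi> x\<bar> \<le> Kp * \<bar>t - 1\<bar> * \<bar>u x * \<phi> x\<bar>"
        by (simp add: abs_mult mult.assoc flip: left_diff_distrib)
    qed
    also have "\<dots> = Kp * \<bar>t - 1\<bar> * S" by (simp add: S_def infsum_cmult_right')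
    finally show ?thesis .
  qed
  have "\<forall>\<^sub>F t in at 1. norm (N t - N 1) \<le> Kp * \<bar>t - 1\<bar> * S"
    unfolding eventually_at using Nb by (intro exI[of _ 1]) (auto simp: dist_real_def abs_less_iff)
  moreover have "((\<lambda>t. Kp * \<bar>t - 1\<bar> * S) \<longlongrightarrow> Kp * \<bar>1 - 1\<bar> * S) (at 1)" by (intro tendsto_intros)
  ultimately have "((\<lambda>t. N t - N 1) \<longlongrightarrow> 0) (at 1)"
    by (intro Lim_null_comparison[of "\<lambda>t. N t - N 1"]) auto
  then have N: "(N \<longlongrightarrow> N 1) (at 1)" by (rule LIM_zero_cancel)
  have eq: "dnrg (\<lambda>x. t * u x) \<phi> = t * (a * E u \<phi> + pot u \<phi>) + b * (t\<^sup>2 * E u u) * (t * E u \<phi>) - N t" for t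
    using u f by (simp add: dnrg_def N_def E_scale E_scale2 pot_scale Hs_l2 algebra_simps)
  have "((\<lambda>t. dnrg (\<lambda>x. t * u x) \<phi>) \<longlongrightarrow>
      1 * (a * E u \<phi> + pot u \<phi>) + b * (1\<^sup>2 * E u u) * (1 * E u \<phi>) - N 1) (at 1)"
    unfolding eq by (intro tendsto_intros N)
  then show ?thesis by (simp add: dnrg_def N_def)
qed

lemma nrg_eq_log_prim:
  assumes "u \<in> Hs"
  shows "nrg u = 1 / 2 * quad u + b / 4 * (E u u)\<^sup>2 - (\<Sum>\<^sub>\<infinity>x. log_prim p (u x))"
proof -
  have "(\<Sum>\<^sub>\<infinity>x. log_prim p (u x)) = 1 / p * lg u - 2 / p\<^sup>2 * pw u"
    unfolding log_prim_def lg_def pw_def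
    by (simp only: infsum_diff_real[OF summable_on_cmult_right[OF lg_summable[OF assms]]
          summable_on_cmult_right[OF pw_summable[OF assms]]] infsum_cmult_right')
  then show ?thesis by (simp add: nrg_def)
qed

lemma log_prim_summable: "u \<in> Hs \<Longrightarrow> (\<lambda>x. log_prim p (u x)) summable_on UNIV"
  unfolding log_prim_def
  by (intro summable_on_diff_real summable_on_cmult_right lg_summable pw_summable)

text \<open>Only an upper bound is stated, since it suffices for the descent argument;
  \<open>K2\<close> is independent of both t and e, because t will be chosen after e.\<close>

lemma nrg_expansion:
  assumes u: "u \<in> Hs" and f: "\<phi> \<in> Hs"
  obtains K2 where "K2 \<ge> 0"
    "\<And>t e. 0 \<le> t \<Longrightarrow> t \<le> 2 \<Longrightarrow> 0 \<le> e \<Longrightarrow> e \<le> 1 \<Longrightarrow>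
      nrg (\<lambda>x. t * u x + e * \<phi> x) \<le> nrg (\<lambda>x. t * u x) + e * dnrg (\<lambda>x. t * u x) \<phi> + K2 * e\<^sup>2"
proof -
  \<comment> \<open>The sum of the two sup bounds, so that 2R covers t u and t u + e \<phi> for t <=
    2 and e <= 1.\<close>
  define R where "R = sqrt (pot u u / h0) + sqrt (pot \<phi> \<phi> / h0)"
  have uR: "\<bar>u x\<bar> \<le> sqrt (pot u u / h0)" "\<bar>\<phi> x\<bar> \<le> sqrt (pot \<phi> \<phi> / h0)" for x
    by (rule Hs_bound[OF u order.refl] Hs_bound[OF f order.refl])+
  obtain Kp where Kp: "Kp \<ge> 0"
    "\<And>x y. \<bar>x\<bar> \<le> 2 * R \<Longrightarrow> \<bar>y\<bar> \<le> 2 * R \<Longrightarrow> \<bar>flog p x - flog p y\<bar> \<le> Kp * \<bar>x - y\<bar>"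
    using flog_lipschitz[OF p] by blast
  define q where "q = (\<Sum>\<^sub>\<infinity>x. (\<phi> x)\<^sup>2)"
  have q: "q \<ge> 0" by (simp add: q_def infsum_nonneg)
  \<comment> \<open>Collects the coefficients of e^2 in the quadratic part, in the square of the
    Dirichlet form and in the Taylor remainder. The factors 2 and 4 bound t and t^2.\<close>
  define K2 where "K2 = 1 / 2 * quad \<phi> + b / 4 * (4 * (2 * E u \<phi>)\<^sup>2 + 2 * (4 * E u u) * E \<phi> \<phi>
      + 4 * (2 * \<bar>E u \<phi>\<bar>) * E \<phi> \<phi> + (E \<phi> \<phi>)\<^sup>2) + Kp * q"
  note l2 = Hs_l2[OF u] Hs_l2[OF f]
  note En = E_nonneg[OF l2(1)] E_nonneg[OF l2(2)]
  have quadf: "quad \<phi> \<ge> 0" using En pot_nonneg[of \<phi>] a by (simp add: quad_def)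
  show ?thesis
  proof (rule that[of K2])
    show "K2 \<ge> 0" using quadf En q Kp b by (simp add: K2_def)
    fix t e :: real assume t: "0 \<le> t" "t \<le> 2" and e: "0 \<le> e" "e \<le> 1"
    define v where "v = (\<lambda>x. t * u x)"
    have v: "v \<in> Hs" unfolding v_def by (rule Hs_scale[OF u])
    define z where "z = (\<lambda>x. v x + e * \<phi> x)"
    have z: "z \<in> Hs" unfolding z_def by (intro Hs_add Hs_scale v f)
    define d where "d = E v \<phi>"
    define g where "g = E \<phi> \<phi>"
    have d: "\<bar>d\<bar> \<le> 2 * \<bar>E u \<phi>\<bar>" using t l2
      by (simp add: d_def v_def E_scale abs_mult mult_right_mono)
    have Ev: "E v v \<le> 4 * E u u"
      using t l2 En power_mono[of t 2 2] by (simp add: v_def E_scale2 mult_right_mono)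
    have Evn: "E v v \<ge> 0" by (rule E_nonneg[OF Hs_l2[OF v]])
    have g: "g \<ge> 0" using En by (simp add: g_def)
    have Ez: "E z z = E v v + 2 * e * d + e\<^sup>2 * g"
      unfolding z_def d_def g_def by (rule E_expand[OF Hs_l2[OF v] l2(2)])
    have pz: "pot z z = pot v v + 2 * e * pot v \<phi> + e\<^sup>2 * pot \<phi> \<phi>"
      unfolding z_def by (rule pot_expand[OF v f])
    have Q: "quad z = quad v + 2 * e * (a * d + pot v \<phi>) + e\<^sup>2 * quad \<phi>"
      by (simp add: quad_def Ez pz g_def algebra_simps)
    have "(E z z)\<^sup>2 = (E v v)\<^sup>2 + 4 * e * (E v v * d) + e\<^sup>2 * (4 * d\<^sup>2 + 2 * E v v * g + 4 * e * d * g + e\<^sup>2 * g\<^sup>2)"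
      unfolding Ez by (simp add: power2_eq_square algebra_simps)
    \<comment> \<open>The cubic and quartic terms in e are absorbed into the e^2 term because e <=
      1.\<close>
    also have "4 * d\<^sup>2 + 2 * E v v * g + 4 * e * d * g + e\<^sup>2 * g\<^sup>2
        \<le> 4 * (2 * E u \<phi>)\<^sup>2 + 2 * (4 * E u u) * g + 4 * (2 * \<bar>E u \<phi>\<bar>) * g + g\<^sup>2"
    proof -
      have "d\<^sup>2 \<le> (2 * E u \<phi>)\<^sup>2" using d by (intro abs_le_square_iff[THEN iffD1]) simp
      moreover have "E v v * g \<le> (4 * E u u) * g" using Ev g by (rule mult_right_mono)
      moreover have "e * d * g \<le> (2 * \<bar>E u \<phi>\<bar>) * g"
      proof (rule mult_right_mono[OF _ g])
        have "e * d \<le> e * \<bar>d\<bar>" using e by (intro mult_left_mono) auto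
        also have "\<dots> \<le> 1 * \<bar>d\<bar>" using e by (intro mult_right_mono) auto
        finally show "e * d \<le> 2 * \<bar>E u \<phi>\<bar>" using d by simp
      qed
      moreover have "e\<^sup>2 * g\<^sup>2 \<le> 1 * g\<^sup>2" using e by (intro mult_right_mono power_le_one) auto
      ultimately show ?thesis by (simp add: mult.assoc)
    qed
    finally have E2: "(E z z)\<^sup>2 \<le> (E v v)\<^sup>2 + 4 * e * (E v v * d) + e\<^sup>2 *
        (4 * (2 * E u \<phi>)\<^sup>2 + 2 * (4 * E u u) * g + 4 * (2 * \<bar>E u \<phi>\<bar>) * g + g\<^sup>2)"
      by (simp add: mult_left_mono)
    let ?F = "\<lambda>x. flog p (v x) * \<phi> x"
    have G: "(\<Sum>\<^sub>\<infinity>x. log_prim p (v x)) + e * infsum ?F UNIV - Kp * e\<^sup>2 * q \<le> (\<Sum>\<^sub>\<infinity>x. log_prim p (z x))"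
    proof -
      have Fs: "?F summable_on UNIV" by (rule flog_mult_summable[OF v f])
      have qs: "(\<lambda>x. (\<phi> x)\<^sup>2) summable_on UNIV" using l2(2) by (simp add: l2_def)
      have "(\<Sum>\<^sub>\<infinity>x. log_prim p (v x)) + e * infsum ?F UNIV - Kp * e\<^sup>2 * q
          = (\<Sum>\<^sub>\<infinity>x. (log_prim p (v x) + e * ?F x) - Kp * e\<^sup>2 * (\<phi> x)\<^sup>2)"
        unfolding q_def
        by (simp only: infsum_diff_real[OF summable_on_add[OF log_prim_summable[OF v] summable_on_cmult_right[OF Fs]]
              summable_on_cmult_right[OF qs]]
              infsum_add[OF log_prim_summable[OF v] summable_on_cmult_right[OF Fs]] infsum_cmult_right')
      also have "\<dots> \<le> (\<Sum>\<^sub>\<infinity>x. log_prim p (z x))"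
      proof (rule infsum_mono)
        show "(\<lambda>x. (log_prim p (v x) + e * ?F x) - Kp * e\<^sup>2 * (\<phi> x)\<^sup>2) summable_on UNIV"
          by (intro summable_on_diff_real summable_on_add summable_on_cmult_right log_prim_summable v Fs qs)
        show "(\<lambda>x. log_prim p (z x)) summable_on UNIV" by (rule log_prim_summable[OF z])
        fix x
        have "\<bar>v x\<bar> \<le> 2 * sqrt (pot u u / h0)"
          using uR(1)[of x] t by (auto simp: v_def abs_mult intro: mult_mono)
        moreover have "\<bar>e * \<phi> x\<bar> \<le> sqrt (pot \<phi> \<phi> / h0)"
          using uR(2)[of x] e mult_mono[of e 1 "\<bar>\<phi> x\<bar>" "sqrt (pot \<phi> \<phi> / h0)"] by (auto simp: abs_mult)
        moreover have "0 \<le> sqrt (pot \<phi> \<phi> / h0)" using pot_nonneg[of \<phi>] h0 by simp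
        ultimately have "\<bar>v x\<bar> \<le> 2 * R" and "\<bar>v x\<bar> + \<bar>e * \<phi> x\<bar> \<le> 2 * R"
          by (simp_all add: R_def)
        from log_prim_taylor[OF p Kp(2) Kp(1) this(1) order.trans[OF abs_triangle_ineq this(2)]]
        have "\<bar>log_prim p (v x + e * \<phi> x) - log_prim p (v x) - flog p (v x) * (e * \<phi> x)\<bar> \<le> Kp * (e * \<phi> x)\<^sup>2" .
        then show "(log_prim p (v x) + e * ?F x) - Kp * e\<^sup>2 * (\<phi> x)\<^sup>2 \<le> log_prim p (z x)"
          by (simp add: z_def power_mult_distrib abs_le_iff mult_ac)
      qed
      finally show ?thesis .
    qed
    have "b / 4 * (E z z)\<^sup>2 \<le> b / 4 * ((E v v)\<^sup>2 + 4 * e * (E v v * d) + e\<^sup>2 *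
        (4 * (2 * E u \<phi>)\<^sup>2 + 2 * (4 * E u u) * g + 4 * (2 * \<bar>E u \<phi>\<bar>) * g + g\<^sup>2))"
      using E2 b by (intro mult_left_mono) auto
    then have "nrg z \<le> nrg v + e * dnrg v \<phi> + K2 * e\<^sup>2"
      using G unfolding nrg_eq_log_prim[OF z] nrg_eq_log_prim[OF v] Q dnrg_def K2_def
        d_def[symmetric] g_def[symmetric]
      by (simp add: algebra_simps)
    then show "nrg (\<lambda>x. t * u x + e * \<phi> x) \<le> nrg (\<lambda>x. t * u x) + e * dnrg (\<lambda>x. t * u x) \<phi> + K2 * e\<^sup>2"
      by (simp add: z_def v_def)
  qed
qed

lemma dnrg_perturbed_tendsto:
  assumes u: "u \<in> Hs" and f: "\<phi> \<in> Hs" and t: "t > 0"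
    and e: "e \<longlonglongrightarrow> 0" "\<And>n. 0 \<le> e n" "\<And>n. e n \<le> 1"
  shows "(\<lambda>n. dnrg (\<lambda>x. t * (u x + e n * \<phi> x)) (\<lambda>x. t * (u x + e n * \<phi> x)))
    \<longlonglongrightarrow> dnrg (\<lambda>x. t * u x) (\<lambda>x. t * u x)"
proof -
  define v where "v n = (\<lambda>x. u x + e n * \<phi> x)" for n
  have v: "v n \<in> Hs" for n unfolding v_def by (intro Hs_add Hs_scale u f)
  have pv: "pot (v n) (v n) = pot u u + 2 * e n * pot u \<phi> + (e n)\<^sup>2 * pot \<phi> \<phi>" for n
    unfolding v_def by (rule pot_expand[OF u f])
  have Ev: "E (v n) (v n) = E u u + 2 * e n * E u \<phi> + (e n)\<^sup>2 * E \<phi> \<phi>" for n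
    unfolding v_def by (rule E_expand[OF Hs_l2[OF u] Hs_l2[OF f]])
  have bound: "pot (v n) (v n) \<le> pot u u + 2 * \<bar>pot u \<phi>\<bar> + pot \<phi> \<phi>" for n
  proof -
    have "e n * pot u \<phi> \<le> e n * \<bar>pot u \<phi>\<bar>" using e(2)[of n] by (intro mult_left_mono) auto
    also have "\<dots> \<le> 1 * \<bar>pot u \<phi>\<bar>" using e(3)[of n] by (intro mult_right_mono) auto
    finally have "e n * pot u \<phi> \<le> \<bar>pot u \<phi>\<bar>" by simp
    moreover have "(e n)\<^sup>2 * pot \<phi> \<phi> \<le> 1 * pot \<phi> \<phi>"
      using e(2,3)[of n] pot_nonneg[of \<phi>] by (intro mult_right_mono power_le_one)
    ultimately show ?thesis unfolding pv by simp
  qed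
  have lim: "(\<lambda>n. v n x) \<longlonglongrightarrow> u x" for x
  proof -
    have "(\<lambda>n. v n x) \<longlonglongrightarrow> u x + 0 * \<phi> x" unfolding v_def by (intro tendsto_intros e)
    then show ?thesis by simp
  qed
  have "(\<lambda>n. E (v n) (v n)) \<longlonglongrightarrow> E u u + 2 * 0 * E u \<phi> + 0\<^sup>2 * E \<phi> \<phi>"
    unfolding Ev by (intro tendsto_intros e)
  then have Ec: "(\<lambda>n. E (v n) (v n)) \<longlonglongrightarrow> E u u" by simp
  have "(\<lambda>n. pot (v n) (v n)) \<longlonglongrightarrow> pot u u + 2 * 0 * pot u \<phi> + 0\<^sup>2 * pot \<phi> \<phi>"
    unfolding pv by (intro tendsto_intros e)
  then have pc: "(\<lambda>n. pot (v n) (v n)) \<longlonglongrightarrow> pot u u" by simp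
  have "(\<lambda>n. dnrg (\<lambda>x. t * v n x) (\<lambda>x. t * v n x)) \<longlonglongrightarrow> dnrg (\<lambda>x. t * u x) (\<lambda>x. t * u x)"
    unfolding dnrg_scaled[OF v t] dnrg_scaled[OF u t] quad_def
    by (intro tendsto_intros Ec pc pw_lg_tendsto[OF v bound lim])
  then show ?thesis by (simp add: v_def)
qed

text \<open>If the derivative in direction \<open>\<phi>\<close> were negative, then \<open>J (t (u + \<epsilon> \<phi>)) < J (t u) \<le> J u\<close>
  for all \<open>t\<close> close to \<open>1\<close>, and one of these \<open>t (u + \<epsilon> \<phi>)\<close> is on the Nehari manifold.\<close>

lemma minimizer_dnrg_nonneg:
  assumes u: "u \<in> nehari" and min: "\<And>v. v \<in> nehari \<Longrightarrow> nrg u \<le> nrg v" and f: "\<phi> \<in> Hs"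
  shows "dnrg u \<phi> \<ge> 0"
proof (rule ccontr)
  assume neg: "\<not> dnrg u \<phi> \<ge> 0"
  define \<eta> where "\<eta> = - dnrg u \<phi>"
  have eta: "\<eta> > 0" using neg by (simp add: \<eta>_def)
  have uH: "u \<in> Hs" "u \<noteq> (\<lambda>x. 0)" "dnrg u u = 0" using u by (auto simp: nehari_def)
  have "\<forall>\<^sub>F t in at 1. dnrg (\<lambda>x. t * u x) \<phi> < - \<eta> / 2"
    using dnrg_ray_continuous[OF uH(1) f] eta by (intro order_tendstoD(2)) (auto simp: \<eta>_def)
  then obtain \<delta>0 where d0: "\<delta>0 > 0"
    "\<And>t. t \<noteq> 1 \<Longrightarrow> \<bar>t - 1\<bar> < \<delta>0 \<Longrightarrow> dnrg (\<lambda>x. t * u x) \<phi> < - \<eta> / 2"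
    by (auto simp: eventually_at dist_real_def)
  define \<delta> where "\<delta> = min (\<delta>0 / 2) (1 / 2)"
  have d: "0 < \<delta>" "\<delta> \<le> 1 / 2" "\<delta> < \<delta>0" using d0(1) by (auto simp: \<delta>_def)
  have slope: "dnrg (\<lambda>x. t * u x) \<phi> \<le> - \<eta> / 2" if "1 - \<delta> \<le> t" "t \<le> 1 + \<delta>" for t
  proof (cases "t = 1")
    case False
    then show ?thesis using d0(2)[of t] that d by (simp add: less_imp_le abs_less_iff)
  qed (use eta in \<open>simp add: \<eta>_def\<close>)
  obtain K2 where K2: "K2 \<ge> 0"
    "\<And>t e. 0 \<le> t \<Longrightarrow> t \<le> 2 \<Longrightarrow> 0 \<le> e \<Longrightarrow> e \<le> 1 \<Longrightarrow>
      nrg (\<lambda>x. t * u x + e * \<phi> x) \<le> nrg (\<lambda>x. t * u x) + e * dnrg (\<lambda>x. t * u x) \<phi> + K2 * e\<^sup>2"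
    using nrg_expansion[OF uH(1) f] by blast
  have s1: "slope_u u 1 = 0"
    using dnrg_eq_slope[OF uH(1,2), of 1] uH(3) by simp
  note sign = fibering.slope_sign[OF fibering_u[OF uH(1,2)] s1]
  define e where "e n = 1 / real (Suc n)" for n
  have e: "e \<longlonglongrightarrow> 0" "\<And>n. 0 < e n" "\<And>n. e n \<le> 1"
    using LIMSEQ_inverse_real_of_nat by (auto simp: e_def[abs_def] inverse_eq_divide)
  note per = dnrg_perturbed_tendsto[OF uH(1) f _ e(1) less_imp_le[OF e(2)] e(3)]
  have "\<forall>\<^sub>F n in sequentially. dnrg (\<lambda>x. (1 - \<delta>) * (u x + e n * \<phi> x)) (\<lambda>x. (1 - \<delta>) * (u x + e n * \<phi> x)) > 0"
    using per[of "1 - \<delta>"] sign(1)[of "1 - \<delta>"] d uH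
    by (intro order_tendstoD(1)) (auto simp: dnrg_eq_slope)
  moreover have "\<forall>\<^sub>F n in sequentially. dnrg (\<lambda>x. (1 + \<delta>) * (u x + e n * \<phi> x)) (\<lambda>x. (1 + \<delta>) * (u x + e n * \<phi> x)) < 0"
    using per[of "1 + \<delta>"] sign(2)[of "1 + \<delta>"] d uH
    by (intro order_tendstoD(2)) (auto simp: dnrg_eq_slope)
  moreover have "\<forall>\<^sub>F n in sequentially. e n < min (1 / 2) (\<eta> / (4 * (K2 + 1)))"
    using eta K2(1) by (intro order_tendstoD(2)[OF e(1)]) auto
  ultimately have "\<forall>\<^sub>F n in sequentially.
      dnrg (\<lambda>x. (1 - \<delta>) * (u x + e n * \<phi> x)) (\<lambda>x. (1 - \<delta>) * (u x + e n * \<phi> x)) > 0 \<and>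
      dnrg (\<lambda>x. (1 + \<delta>) * (u x + e n * \<phi> x)) (\<lambda>x. (1 + \<delta>) * (u x + e n * \<phi> x)) < 0 \<and>
      e n < min (1 / 2) (\<eta> / (4 * (K2 + 1)))"
    by eventually_elim auto
  then obtain n where n:
      "dnrg (\<lambda>x. (1 - \<delta>) * (u x + e n * \<phi> x)) (\<lambda>x. (1 - \<delta>) * (u x + e n * \<phi> x)) > 0"
      "dnrg (\<lambda>x. (1 + \<delta>) * (u x + e n * \<phi> x)) (\<lambda>x. (1 + \<delta>) * (u x + e n * \<phi> x)) < 0"
      "e n < min (1 / 2) (\<eta> / (4 * (K2 + 1)))"
    by (auto simp: eventually_sequentially)
  define v where "v = (\<lambda>x. u x + e n * \<phi> x)"
  have v: "v \<in> Hs" unfolding v_def by (intro Hs_add Hs_scale uH f)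
  have v0: "v \<noteq> (\<lambda>x. 0)"
  proof
    assume "v = (\<lambda>x. 0)"
    then have "u x + e n * \<phi> x = 0" for x by (simp add: v_def fun_eq_iff)
    then have "dnrg (\<lambda>x. 0) (\<lambda>x. 0) > 0" "dnrg (\<lambda>x. 0) (\<lambda>x. 0) < 0" using n(1,2) by simp_all
    then show False by simp
  qed
  have "slope_u v (1 + \<delta>) \<le> 0" "0 \<le> slope_u v (1 - \<delta>)"
    using n(1,2) d v v0 by (auto simp flip: dnrg_eq_slope simp: v_def)
  moreover have "continuous_on {1 - \<delta>..1 + \<delta>} (slope_u v)"
    by (rule continuous_on_subset[OF fibering.continuous_on_slope[OF fibering_u[OF v v0]]]) (use d in auto)
  ultimately obtain t where t: "1 - \<delta> \<le> t" "t \<le> 1 + \<delta>" "slope_u v t = 0"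
    using IVT2'[of "slope_u v" "1 + \<delta>" 0 "1 - \<delta>"] d by auto
  have t0: "t > 0" "t \<le> 2" using t d by auto
  have tv: "(\<lambda>x. t * v x) \<in> nehari"
    using t t0 v v0 by (auto simp: nehari_def Hs_scale dnrg_eq_slope fun_eq_iff)
  have te: "0 < t * e n" "t * e n \<le> 1"
    using t0 e(2)[of n] n(3) mult_mono[of t 2 "e n" "1 / 2"] by auto
  have "nrg u \<le> nrg (\<lambda>x. t * v x)" by (rule min[OF tv])
  also have "(\<lambda>x. t * v x) = (\<lambda>x. t * u x + (t * e n) * \<phi> x)"
    by (simp add: v_def algebra_simps)
  also have "nrg \<dots> \<le> nrg (\<lambda>x. t * u x) + (t * e n) * dnrg (\<lambda>x. t * u x) \<phi> + K2 * (t * e n)\<^sup>2"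
    using t0 te by (intro K2(2)) auto
  also have "\<dots> \<le> nrg (\<lambda>x. t * u x) + (t * e n) * (- \<eta> / 2) + K2 * (t * e n)\<^sup>2"
    using mult_left_mono[OF slope[OF t(1,2)] less_imp_le[OF te(1)]] by linarith
  also have "\<dots> = nrg (\<lambda>x. t * u x) + (t * e n) * (K2 * (t * e n) - \<eta> / 2)"
    by (simp add: power2_eq_square algebra_simps)
  also have "\<dots> < nrg (\<lambda>x. t * u x)"
  proof -
    have "(K2 + 1) * (t * e n) \<le> (K2 + 1) * (2 * e n)"
      using K2(1) t0 e(2)[of n] by (intro mult_left_mono mult_right_mono) auto
    also have "\<dots> < \<eta> / 2" using n(3) K2(1) by (simp add: field_simps)
    finally have "K2 * (t * e n) - \<eta> / 2 < 0" using te by (simp add: algebra_simps)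
    then show ?thesis using te(1) by (simp add: mult_pos_neg)
  qed
  also have "nrg (\<lambda>x. t * u x) \<le> nrg (\<lambda>x. 1 * u x)"
    using fibering.height_le[OF fibering_u[OF uH(1,2)] s1 t0(1)] uH t0 nrg_eq_height[OF uH(1,2), of 1]
    by (simp add: nrg_eq_height)
  finally show False by simp
qed

theorem ground_state_exists:
  obtains u where "u \<in> nehari" "\<And>\<phi>. \<phi> \<in> Hs \<Longrightarrow> dnrg u \<phi> = 0" "nrg u = (INF v\<in>nehari. nrg v)"
proof -
  obtain u where u: "u \<in> nehari" "\<And>v. v \<in> nehari \<Longrightarrow> nrg u \<le> nrg v"
    using minimizer_exists by blast
  have "dnrg u \<phi> = 0" if "\<phi> \<in> Hs" for \<phi>
    using minimizer_dnrg_nonneg[OF u that] minimizer_dnrg_nonneg[OF u Hs_scale[OF that, of "-1"]]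
      dnrg_uminus[OF _ that, of u] u(1) by (auto simp: nehari_def)
  moreover have "nrg u = (INF v\<in>nehari. nrg v)"
    using u by (intro cInf_eq_minimum[symmetric]) auto
  ultimately show ?thesis using u(1) that by blast
qed

end

section \<open>Lattice kernels\<close>

lemma summable_on_int_powr:
  fixes q :: real
  assumes "q < -1"
  shows "(\<lambda>k::int. (1 + \<bar>real_of_int k\<bar>) powr q) summable_on UNIV"
proof -
  let ?g = "\<lambda>k::int. (1 + \<bar>real_of_int k\<bar>) powr q"
  have "summable (\<lambda>n::nat. real (Suc n) powr q)"
    using assms summable_real_powr_iff[of q] summable_Suc_iff[of "\<lambda>n. real n powr q"] by simp
  then have n: "(\<lambda>n::nat. (1 + real n) powr q) summable_on UNIV"
    by (intro summable_nonneg_imp_summable_on) (auto simp: add.commute)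
  have "(\<lambda>n. ?g (int n)) summable_on UNIV \<longleftrightarrow> ?g summable_on {0..}"
    by (intro summable_on_reindex_bij_betw bij_betwI[of _ _ _ nat]) auto
  moreover have "(\<lambda>n. ?g (- int n)) summable_on UNIV \<longleftrightarrow> ?g summable_on {..0}"
    by (intro summable_on_reindex_bij_betw bij_betwI[of _ _ _ "\<lambda>k. nat (- k)"]) auto
  ultimately have "?g summable_on {0..} \<union> {..0}"
    using n by (intro summable_on_union) auto
  moreover have "{0..} \<union> {..0} = (UNIV :: int set)" by auto
  ultimately show ?thesis by simp
qed

lemma vec_box_image: "vec_nth ` {y :: 'a^'n. \<forall>i. y $ i \<in> S} \<subseteq> Pi\<^sub>E UNIV (\<lambda>_. S)"
  by auto

lemma finite_vec_box:
  assumes "finite S"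
  shows "finite {y :: 'a^'n. \<forall>i. y $ i \<in> S}"
proof (rule inj_on_finite[OF _ vec_box_image])
  show "inj_on vec_nth {y :: 'a^'n. \<forall>i. y $ i \<in> S}" by (auto simp: inj_on_def vec_nth_inject)
  show "finite (Pi\<^sub>E (UNIV :: 'n set) (\<lambda>_. S))" using assms by (intro finite_PiE) auto
qed

lemma summable_on_vec_prod:
  fixes g :: "'a \<Rightarrow> real"
  assumes g: "g summable_on UNIV" and pos: "\<And>k. g k \<ge> 0"
  shows "(\<lambda>y :: 'a^'n. \<Prod>i\<in>UNIV. g (y $ i)) summable_on UNIV"
proof (rule nonneg_bdd_above_summable_on)
  show "0 \<le> (\<Prod>i\<in>UNIV. g (y $ i))" for y :: "'a^'n" using pos by (intro prod_nonneg) auto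
  show "bdd_above (sum (\<lambda>y :: 'a^'n. \<Prod>i\<in>UNIV. g (y $ i)) ` {F. F \<subseteq> UNIV \<and> finite F})"
  proof (rule bdd_aboveI2)
    fix F :: "('a^'n) set" assume "F \<in> {F. F \<subseteq> UNIV \<and> finite F}"
    then have F: "finite F" by simp
    define S where "S = (\<Union>y\<in>F. range (vec_nth y))"
    have S: "finite S" using F by (auto simp: S_def)
    have "(\<Sum>y\<in>F. \<Prod>i\<in>UNIV. g (y $ i)) = (\<Sum>f\<in>vec_nth ` F. \<Prod>i\<in>UNIV. g (f i))"
      by (subst sum.reindex) (auto simp: inj_on_def vec_nth_inject)
    also have "\<dots> \<le> (\<Sum>f\<in>Pi\<^sub>E (UNIV :: 'n set) (\<lambda>_. S). \<Prod>i\<in>UNIV. g (f i))"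
    proof (rule sum_mono2)
      show "finite (Pi\<^sub>E (UNIV :: 'n set) (\<lambda>_. S))" using S by (intro finite_PiE) auto
      show "vec_nth ` F \<subseteq> Pi\<^sub>E UNIV (\<lambda>_. S)" by (auto simp: S_def)
    qed (use pos in \<open>auto intro: prod_nonneg\<close>)
    also have "\<dots> = (\<Prod>i\<in>(UNIV :: 'n set). \<Sum>k\<in>S. g k)"
      using S by (subst prod_sum_PiE) auto
    also have "\<dots> \<le> (\<Prod>i\<in>(UNIV :: 'n set). infsum g UNIV)"
      using S pos g by (intro prod_mono conjI sum_nonneg finite_sum_le_infsum) auto
    finally show "(\<Sum>y\<in>F. \<Prod>i\<in>UNIV. g (y $ i)) \<le> (\<Prod>i\<in>(UNIV :: 'n set). infsum g UNIV)" .
  qed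
qed

definition norm1 :: "int^'n \<Rightarrow> real" where
  "norm1 z = real_of_int (dist1 z 0)"

lemma norm1_eq: "norm1 z = (\<Sum>i\<in>UNIV. \<bar>real_of_int (z $ i)\<bar>)"
  by (simp add: norm1_def dist1_def)

lemma dist1_eq_norm1: "real_of_int (dist1 x y) = norm1 (x - y)"
  by (simp add: norm1_def dist1_def)

lemma coord_le_norm1: "\<bar>real_of_int (z $ i)\<bar> \<le> norm1 z"
  unfolding norm1_eq by (rule member_le_sum) auto

lemma norm1_ge_1:
  assumes "z \<noteq> 0"
  shows "norm1 z \<ge> 1"
proof -
  obtain i where "z $ i \<noteq> 0" using assms by (auto simp: vec_eq_iff)
  then have "1 \<le> \<bar>real_of_int (z $ i)\<bar>" by linarith
  then show ?thesis using coord_le_norm1[of z i] by linarith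
qed

text \<open>Each \<open>1 + |z\<^sub>i|\<close> is at most \<open>1 + |z|\<close>, so \<open>(1 + |z|)\<^bsup>-d-\<sigma>\<^esup>\<close> is dominated by
  the product of the one-dimensional terms \<open>(1 + |z\<^sub>i|)\<^bsup>-1-\<sigma>/d\<^esup>\<close>.\<close>

lemma summable_on_lattice_powr:
  fixes \<sigma> :: real
  assumes "\<sigma> > 0"
  shows "(\<lambda>z :: int^'n. if z = 0 then 0 else norm1 z powr (- real CARD('n) - \<sigma>)) summable_on UNIV"
proof -
  define d where "d = real CARD('n)"
  have d: "d > 0" by (simp add: d_def)
  define q where "q = - 1 - \<sigma> / d"
  have q: "q < -1" using assms d by (simp add: q_def)
  let ?P = "\<lambda>z :: int^'n. \<Prod>i\<in>UNIV. (1 + \<bar>real_of_int (z $ i)\<bar>) powr q"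
  have "?P summable_on UNIV"
    by (rule summable_on_vec_prod[OF summable_on_int_powr[OF q]]) simp
  then have "(\<lambda>z. 2 powr (d + \<sigma>) * ?P z) summable_on UNIV" by (rule summable_on_cmult_right)
  then show ?thesis
  proof (rule summable_on_real_comparison)
    fix z :: "int^'n"
    show "\<bar>if z = 0 then 0 else norm1 z powr (- real CARD('n) - \<sigma>)\<bar> \<le> 2 powr (d + \<sigma>) * ?P z"
    proof (cases "z = 0")
      case False
      have N: "norm1 z \<ge> 1" using norm1_ge_1[OF False] .
      have "norm1 z powr (- d - \<sigma>) \<le> ((1 + norm1 z) / 2) powr (- d - \<sigma>)"
        using N d assms by (intro powr_mono2') auto
      also have "\<dots> = 2 powr (d + \<sigma>) * (1 + norm1 z) powr (- d - \<sigma>)"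
      proof -
        have "2 powr (- d - \<sigma>) * 2 powr (d + \<sigma>) = (1::real)" by (simp flip: powr_add)
        then show ?thesis using N by (simp add: powr_divide field_simps)
      qed
      also have "(1 + norm1 z) powr (- d - \<sigma>) = (\<Prod>i\<in>(UNIV :: 'n set). (1 + norm1 z) powr q)"
      proof -
        have "q * d = - d - \<sigma>" using d by (simp add: q_def field_simps)
        then show ?thesis using N by (simp add: powr_powr d_def flip: powr_realpow)
      qed
      also have "\<dots> \<le> ?P z"
      proof (rule prod_mono, rule conjI)
        fix i
        show "(1 + norm1 z) powr q \<le> (1 + \<bar>real_of_int (z $ i)\<bar>) powr q"
          using coord_le_norm1[of z i] q by (intro powr_mono2') auto
      qed simp
      finally show ?thesis using False by (simp add: d_def mult_left_mono)
    qed (auto intro!: mult_nonneg_nonneg prod_nonneg)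
  qed
qed

locale summable_kernel =
  fixes w :: "int^'n \<Rightarrow> int^'n \<Rightarrow> real" and W :: real
  assumes w_sym: "\<And>x y. x \<noteq> y \<Longrightarrow> w x y = w y x"
    and w_nonneg: "\<And>x y. x \<noteq> y \<Longrightarrow> w x y \<ge> 0"
    and w_row_summable: "\<And>x. w x summable_on {y. y \<noteq> x}"
    and w_row: "\<And>x. infsum (w x) {y. y \<noteq> x} \<le> W"
begin

definition w0 :: "int^'n \<Rightarrow> int^'n \<Rightarrow> real" where
  "w0 x y = (if x = y then 0 else w x y)"

lemma w0_sym: "w0 x y = w0 y x"
  using w_sym[of x y] by (auto simp: w0_def)

lemma w0_nonneg: "w0 x y \<ge> 0"
  using w_nonneg[of x y] by (auto simp: w0_def)

lemma w0_summable: "w0 x summable_on UNIV"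
  using w_row_summable[of x] summable_on_cong_neutral[of UNIV "{y. y \<noteq> x}" "w0 x" "w x"]
  by (auto simp: w0_def)

lemma w0_row: "infsum (w0 x) UNIV \<le> W"
  using w_row[of x] infsum_cong_neutral[of "{y. y \<noteq> x}" UNIV "w x" "w0 x"]
  by (auto simp: w0_def)

lemma gradprod_eq: "gradprod w u v x = 1 / 2 * (\<Sum>\<^sub>\<infinity>y. w0 x y * (u x - u y) * (v x - v y))"
  unfolding gradprod_def
  by (intro arg_cong[of _ _ "(*) (1/2)"] infsum_cong_neutral) (auto simp: w0_def)

lemma square_pair_summable:
  assumes "u \<in> l2"
  shows "(\<lambda>(x, y). w0 x y * (u x)\<^sup>2) summable_on UNIV"
    and "(\<Sum>\<^sub>\<infinity>(x, y). w0 x y * (u x)\<^sup>2) \<le> W * (\<Sum>\<^sub>\<infinity>x. (u x)\<^sup>2)"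
proof -
  have u: "(\<lambda>x. W * (u x)\<^sup>2) summable_on UNIV"
    using assms by (intro summable_on_cmult_right) (auto simp: l2_def)
  have row: "0 \<le> infsum (w0 x) UNIV" for x using w0_nonneg by (intro infsum_nonneg)
  have rs: "(\<lambda>x. infsum (w0 x) UNIV * (u x)\<^sup>2) summable_on UNIV"
    by (rule summable_on_real_comparison[OF u])
       (use row w0_row in \<open>auto simp: abs_mult intro: mult_right_mono\<close>)
  have "(\<lambda>(x, y). w0 x y * (u x)\<^sup>2) summable_on (SIGMA x:UNIV. UNIV)"
  proof (rule summable_on_SigmaI[OF _ rs])
    show "((\<lambda>y. case (x, y) of (x, y) \<Rightarrow> w0 x y * (u x)\<^sup>2) has_sum infsum (w0 x) UNIV * (u x)\<^sup>2) UNIV" for x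
      using has_sum_cmult_left[OF has_sum_infsum[OF w0_summable]] by simp
  qed (use w0_nonneg in auto)
  then show *: "(\<lambda>(x, y). w0 x y * (u x)\<^sup>2) summable_on UNIV" by simp
  have "(\<Sum>\<^sub>\<infinity>(x, y). w0 x y * (u x)\<^sup>2) = (\<Sum>\<^sub>\<infinity>x. \<Sum>\<^sub>\<infinity>y. w0 x y * (u x)\<^sup>2)"
    using infsum_Sigma'_banach[of "\<lambda>x y. w0 x y * (u x)\<^sup>2" UNIV "\<lambda>_. UNIV"] * by simp
  also have "\<dots> = (\<Sum>\<^sub>\<infinity>x. infsum (w0 x) UNIV * (u x)\<^sup>2)"
    by (simp add: infsum_cmult_left')
  also have "\<dots> \<le> (\<Sum>\<^sub>\<infinity>x. W * (u x)\<^sup>2)"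
    using w0_row by (intro infsum_mono rs u mult_right_mono) auto
  finally show "(\<Sum>\<^sub>\<infinity>(x, y). w0 x y * (u x)\<^sup>2) \<le> W * (\<Sum>\<^sub>\<infinity>x. (u x)\<^sup>2)"
    by (simp add: infsum_cmult_right')
qed

lemma square_pair_summable_swap:
  assumes "u \<in> l2"
  shows "(\<lambda>(x, y). w0 x y * (u y)\<^sup>2) summable_on UNIV"
    and "(\<Sum>\<^sub>\<infinity>(x, y). w0 x y * (u y)\<^sup>2) = (\<Sum>\<^sub>\<infinity>(x, y). w0 x y * (u x)\<^sup>2)"
proof -
  have b: "bij_betw prod.swap UNIV (UNIV :: ((int^'n) \<times> (int^'n)) set)" by (simp add: bij_swap)
  have eq: "(\<lambda>z. (\<lambda>(x, y). w0 x y * (u x)\<^sup>2) (prod.swap z)) = (\<lambda>(x, y). w0 x y * (u y)\<^sup>2)"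
    by (auto simp: fun_eq_iff w0_sym)
  show "(\<lambda>(x, y). w0 x y * (u y)\<^sup>2) summable_on UNIV"
    using summable_on_reindex_bij_betw[OF b, of "\<lambda>(x, y). w0 x y * (u x)\<^sup>2"] square_pair_summable(1)[OF assms]
    unfolding eq by simp
  show "(\<Sum>\<^sub>\<infinity>(x, y). w0 x y * (u y)\<^sup>2) = (\<Sum>\<^sub>\<infinity>(x, y). w0 x y * (u x)\<^sup>2)"
    using infsum_reindex_bij_betw[OF b, of "\<lambda>(x, y). w0 x y * (u x)\<^sup>2"] unfolding eq .
qed

lemma diff_square_pair_summable:
  assumes "u \<in> l2"
  shows "(\<lambda>(x, y). w0 x y * (u x - u y)\<^sup>2) summable_on UNIV"
    and "(\<Sum>\<^sub>\<infinity>(x, y). w0 x y * (u x - u y)\<^sup>2) \<le> 4 * W * (\<Sum>\<^sub>\<infinity>x. (u x)\<^sup>2)"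
proof -
  let ?A = "\<lambda>(x, y). w0 x y * (u x)\<^sup>2" and ?B = "\<lambda>(x, y). w0 x y * (u y)\<^sup>2"
  have s: "(\<lambda>z. 2 * ?A z + 2 * ?B z) summable_on UNIV"
    by (intro summable_on_add summable_on_cmult_right square_pair_summable(1)
        square_pair_summable_swap(1) assms)
  have le: "(case z of (x, y) \<Rightarrow> w0 x y * (u x - u y)\<^sup>2) \<le> 2 * ?A z + 2 * ?B z" for z
  proof (cases z)
    case (Pair x y)
    show ?thesis
      using mult_left_mono[OF square_diff_le[of "u x" "u y"] w0_nonneg[of x y]]
      by (simp add: Pair algebra_simps)
  qed
  show *: "(\<lambda>(x, y). w0 x y * (u x - u y)\<^sup>2) summable_on UNIV"
    by (rule summable_on_real_comparison[OF s]) (use le w0_nonneg in \<open>force simp: abs_mult\<close>)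
  have "(\<Sum>\<^sub>\<infinity>(x, y). w0 x y * (u x - u y)\<^sup>2) \<le> (\<Sum>\<^sub>\<infinity>z. 2 * ?A z + 2 * ?B z)"
    by (rule infsum_mono[OF * s le])
  also have "\<dots> = 2 * infsum ?A UNIV + 2 * infsum ?B UNIV"
    by (simp only: infsum_add[OF summable_on_cmult_right[OF square_pair_summable(1)[OF assms]]
          summable_on_cmult_right[OF square_pair_summable_swap(1)[OF assms]]] infsum_cmult_right')
  also have "\<dots> = 4 * infsum ?A UNIV" by (simp add: square_pair_summable_swap(2)[OF assms])
  also have "\<dots> \<le> 4 * (W * (\<Sum>\<^sub>\<infinity>x. (u x)\<^sup>2))"
    using square_pair_summable(2)[OF assms] by simp
  finally show "(\<Sum>\<^sub>\<infinity>(x, y). w0 x y * (u x - u y)\<^sup>2) \<le> 4 * W * (\<Sum>\<^sub>\<infinity>x. (u x)\<^sup>2)" by simp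
qed

lemma pair_summable:
  assumes "u \<in> l2" "v \<in> l2"
  shows "(\<lambda>(x, y). w0 x y * (u x - u y) * (v x - v y)) summable_on UNIV"
proof (rule summable_on_real_comparison)
  show "(\<lambda>z. (case z of (x, y) \<Rightarrow> w0 x y * (u x - u y)\<^sup>2) + (case z of (x, y) \<Rightarrow> w0 x y * (v x - v y)\<^sup>2)) summable_on UNIV"
    by (intro summable_on_add diff_square_pair_summable assms)
  fix z :: "(int^'n) \<times> (int^'n)"
  obtain x y where z: "z = (x, y)" by (cases z)
  show "\<bar>case z of (x, y) \<Rightarrow> w0 x y * (u x - u y) * (v x - v y)\<bar>
      \<le> (case z of (x, y) \<Rightarrow> w0 x y * (u x - u y)\<^sup>2) + (case z of (x, y) \<Rightarrow> w0 x y * (v x - v y)\<^sup>2)"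
    using mult_left_mono[OF abs_mult_le_sum_squares[of "u x - u y" "v x - v y"] w0_nonneg[of x y]] w0_nonneg[of x y]
    by (simp add: z abs_mult distrib_left mult.assoc)
qed

lemma row_summable:
  assumes "u \<in> l2" "v \<in> l2"
  shows "(\<lambda>y. w0 x y * (u x - u y) * (v x - v y)) summable_on UNIV"
  using summable_on_SigmaD1[of "\<lambda>x y. w0 x y * (u x - u y) * (v x - v y)" UNIV "\<lambda>_. UNIV" x]
    pair_summable[OF assms] by simp

lemma gradprod_summable:
  assumes "u \<in> l2" "v \<in> l2"
  shows "gradprod w u v summable_on UNIV"
  using summable_on_cmult_right[OF summable_on_Sigma_banach[of "\<lambda>x y. w0 x y * (u x - u y) * (v x - v y)" UNIV "\<lambda>_. UNIV"], of "1/2"]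
    pair_summable[OF assms] by (simp add: gradprod_eq[abs_def])

definition form :: "(int^'n \<Rightarrow> real) \<Rightarrow> (int^'n \<Rightarrow> real) \<Rightarrow> real" where
  "form u v = (\<Sum>\<^sub>\<infinity>x. gradprod w u v x)"

lemma gradprod_nonneg: "gradprod w u u x \<ge> 0"
  unfolding gradprod_eq using w0_nonneg by (auto intro!: infsum_nonneg simp: mult.assoc)

lemma form_bound:
  assumes "u \<in> l2"
  shows "form u u \<le> 2 * W * (\<Sum>\<^sub>\<infinity>x. (u x)\<^sup>2)"
proof -
  have "form u u = 1 / 2 * (\<Sum>\<^sub>\<infinity>x. \<Sum>\<^sub>\<infinity>y. w0 x y * (u x - u y)\<^sup>2)"
    unfolding form_def gradprod_eq by (simp only: infsum_cmult_right' power2_eq_square mult.assoc)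
  also have "\<dots> = 1 / 2 * (\<Sum>\<^sub>\<infinity>(x, y). w0 x y * (u x - u y)\<^sup>2)"
    using infsum_Sigma'_banach[of "\<lambda>x y. w0 x y * (u x - u y)\<^sup>2" UNIV "\<lambda>_. UNIV"]
      diff_square_pair_summable(1)[OF assms] by simp
  finally show ?thesis using diff_square_pair_summable(2)[OF assms] by simp
qed

lemma gradprod_add:
  assumes "u \<in> l2" "v \<in> l2" "z \<in> l2"
  shows "gradprod w (\<lambda>x. u x + v x) z x = gradprod w u z x + gradprod w v z x"
  using infsum_add[OF row_summable[OF assms(1,3), of x] row_summable[OF assms(2,3), of x]]
  by (simp add: gradprod_eq algebra_simps)

lemma gradprod_scale: "gradprod w (\<lambda>x. c * u x) z x = c * gradprod w u z x"
proof -
  have "(\<Sum>\<^sub>\<infinity>y. w0 x y * (c * u x - c * u y) * (z x - z y)) = (\<Sum>\<^sub>\<infinity>y. c * (w0 x y * (u x - u y) * (z x - z y)))"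
    by (intro infsum_cong) (simp add: algebra_simps)
  then show ?thesis by (simp add: gradprod_eq infsum_cmult_right')
qed

lemma gradprod_sym: "gradprod w u v x = gradprod w v u x"
  by (simp add: gradprod_eq mult_ac)

lemma Wsp_eq_l2: "Wsp w = l2"
proof (intro equalityI subsetI)
  fix u assume "u \<in> Wsp w"
  then have s: "(\<lambda>x. gradsq w u x + (u x)\<^sup>2) summable_on UNIV" by (simp add: Wsp_def)
  show "u \<in> l2" unfolding l2_def mem_Collect_eq
    by (rule summable_on_real_comparison[OF s]) (use gradprod_nonneg in \<open>auto simp: gradsq_def\<close>)
next
  fix u :: "int^'n \<Rightarrow> real" assume u: "u \<in> l2"
  then have u2: "(\<lambda>x. (u x)\<^sup>2) summable_on UNIV" by (simp add: l2_def)
  have s: "(\<lambda>x. gradsq w u x + (u x)\<^sup>2) summable_on UNIV" if "u \<in> l2" for u :: "int^'n \<Rightarrow> real"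
    using that gradprod_summable[OF that that] by (auto simp: gradsq_def[abs_def] l2_def intro: summable_on_add)
  have Wn: "0 \<le> Wnorm2 w v" "Wnorm2 w v \<le> (2 * W + 1) * (\<Sum>\<^sub>\<infinity>x. (v x)\<^sup>2)" if v: "v \<in> l2" for v
  proof -
    show "0 \<le> Wnorm2 w v" unfolding Wnorm2_def gradsq_def
      by (intro infsum_nonneg add_nonneg_nonneg gradprod_nonneg) simp
    have v2: "(\<lambda>x. (v x)\<^sup>2) summable_on UNIV" using v by (simp add: l2_def)
    have "Wnorm2 w v = form v v + (\<Sum>\<^sub>\<infinity>x. (v x)\<^sup>2)"
      unfolding Wnorm2_def form_def gradsq_def by (rule infsum_add[OF gradprod_summable[OF v v] v2])
    then show "Wnorm2 w v \<le> (2 * W + 1) * (\<Sum>\<^sub>\<infinity>x. (v x)\<^sup>2)"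
      using form_bound[OF v] by (simp add: algebra_simps)
  qed
  have "\<exists>F. finite F \<and> (\<Sum>\<^sub>\<infinity>x. (u x)\<^sup>2) - (\<Sum>x\<in>F. (u x)\<^sup>2) \<le> 1 / real (Suc n)" for n
  proof -
    obtain F where "finite F" "dist (\<Sum>x\<in>F. (u x)\<^sup>2) (\<Sum>\<^sub>\<infinity>x. (u x)\<^sup>2) \<le> 1 / real (Suc n)"
      using infsum_finite_approximation[OF u2, of "1 / real (Suc n)"] by auto
    then show ?thesis by (intro exI[of _ F]) (simp add: dist_real_def abs_le_iff)
  qed
  then obtain F where F: "\<And>n. finite (F n)"
    "\<And>n. (\<Sum>\<^sub>\<infinity>x. (u x)\<^sup>2) - (\<Sum>x\<in>F n. (u x)\<^sup>2) \<le> 1 / real (Suc n)" by metis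
  define \<phi> where "\<phi> n x = (if x \<in> F n then u x else 0)" for n x
  have fs: "fin_supp (\<phi> n)" for n
    unfolding fin_supp_def by (rule finite_subset[OF _ F(1)[of n]]) (auto simp: \<phi>_def)
  have sq: "((\<lambda>x. (\<phi> n x - u x)\<^sup>2) has_sum ((\<Sum>\<^sub>\<infinity>x. (u x)\<^sup>2) - (\<Sum>x\<in>F n. (u x)\<^sup>2))) UNIV" for n
  proof -
    have "((\<lambda>x. if x \<in> F n then (u x)\<^sup>2 else 0) has_sum (\<Sum>x\<in>F n. (u x)\<^sup>2)) UNIV"
      by (rule has_sum_finite_neutralI[OF F(1)[of n]]) auto
    then have "((\<lambda>x. (u x)\<^sup>2 + - (if x \<in> F n then (u x)\<^sup>2 else 0)) has_sum
        ((\<Sum>\<^sub>\<infinity>x. (u x)\<^sup>2) + - (\<Sum>x\<in>F n. (u x)\<^sup>2))) UNIV"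
      by (intro has_sum_add has_sum_infsum[OF u2] has_sum_uminusI)
    moreover have "(\<lambda>x. (u x)\<^sup>2 + - (if x \<in> F n then (u x)\<^sup>2 else 0)) = (\<lambda>x. (\<phi> n x - u x)\<^sup>2)"
      by (auto simp: \<phi>_def)
    ultimately show ?thesis by simp
  qed
  have l2n: "(\<lambda>x. \<phi> n x - u x) \<in> l2" for n
    using has_sum_imp_summable[OF sq] by (simp add: l2_def)
  have W0: "W \<ge> 0" using infsum_nonneg[of UNIV "w0 0"] w0_nonneg w0_row[of 0] by force
  have "(\<lambda>n. Wnorm2 w (\<lambda>x. \<phi> n x - u x)) \<longlonglongrightarrow> 0"
  proof (rule tendsto_sandwich)
    show "\<forall>\<^sub>F n in sequentially. 0 \<le> Wnorm2 w (\<lambda>x. \<phi> n x - u x)"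
      using Wn(1)[OF l2n] by simp
    have "Wnorm2 w (\<lambda>x. \<phi> n x - u x) \<le> (2 * W + 1) * (1 / real (Suc n))" for n
    proof -
      have "(2 * W + 1) * (\<Sum>\<^sub>\<infinity>x. (\<phi> n x - u x)\<^sup>2) \<le> (2 * W + 1) * (1 / real (Suc n))"
        unfolding infsumI[OF sq] using W0 F(2)[of n] by (intro mult_left_mono) auto
      then show ?thesis using Wn(2)[OF l2n[of n]] by linarith
    qed
    then show "\<forall>\<^sub>F n in sequentially. Wnorm2 w (\<lambda>x. \<phi> n x - u x) \<le> (2 * W + 1) * (1 / real (Suc n))"
      by simp
    have "(\<lambda>n. 1 / real (Suc n)) \<longlonglongrightarrow> 0"
      using LIMSEQ_inverse_real_of_nat by (simp add: inverse_eq_divide)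
    from tendsto_mult[OF tendsto_const this]
    show "(\<lambda>n. (2 * W + 1) * (1 / real (Suc n))) \<longlonglongrightarrow> 0" by simp
  qed simp
  then show "u \<in> Wsp w" unfolding Wsp_def using s[OF u] fs by blast
qed

end

lemma summable_kernel_of_decay:
  fixes w :: "int^'n \<Rightarrow> int^'n \<Rightarrow> real" and C \<sigma> :: real
  assumes s: "\<sigma> > 0"
    and w_sym: "\<And>x y. x \<noteq> y \<Longrightarrow> w x y = w y x"
    and w_nonneg: "\<And>x y. x \<noteq> y \<Longrightarrow> w x y \<ge> 0"
    and w_upper: "\<And>x y. x \<noteq> y \<Longrightarrow>
         w x y \<le> C * real_of_int (dist1 x y) powr (- real CARD('n) - \<sigma>)"
  obtains W where "summable_kernel w W"
proof -
  define k where "k z = C * (if z = 0 then 0 else norm1 z powr (- real CARD('n) - \<sigma>))" for z :: "int^'n"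
  have k: "k summable_on UNIV"
    unfolding k_def by (rule summable_on_cmult_right[OF summable_on_lattice_powr[OF s]])
  have bij: "bij_betw (\<lambda>y. x - y) UNIV UNIV" for x :: "int^'n"
    by (rule bij_betwI[of _ _ _ "\<lambda>y. x - y"]) auto
  have kx: "(\<lambda>y. k (x - y)) summable_on UNIV" "(\<Sum>\<^sub>\<infinity>y. k (x - y)) = infsum k UNIV" for x
    using summable_on_reindex_bij_betw[OF bij, of k x] infsum_reindex_bij_betw[OF bij, of k x] k by auto
  have le: "w x y \<le> k (x - y)" if "y \<noteq> x" for x y
    using w_upper[of x y] that by (auto simp: k_def dist1_eq_norm1)
  have kx': "(\<lambda>y. k (x - y)) summable_on {y. y \<noteq> x}" for x
    by (rule summable_on_subset_banach[OF kx(1)]) auto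
  have ws: "w x summable_on {y. y \<noteq> x}" for x
    by (rule summable_on_real_comparison[OF kx'[of x]]) (use le w_nonneg[of x] in force)
  have "infsum (w x) {y. y \<noteq> x} \<le> infsum k UNIV" for x
  proof -
    have "infsum (w x) {y. y \<noteq> x} \<le> (\<Sum>\<^sub>\<infinity>y\<in>{y. y \<noteq> x}. k (x - y))"
      using le by (intro infsum_mono ws kx') auto
    also have "\<dots> = infsum k UNIV"
      unfolding kx(2)[of x, symmetric] by (rule infsum_cong_neutral) (auto simp: k_def)
    finally show ?thesis .
  qed
  then have "summable_kernel w (infsum k UNIV)"
    using w_sym w_nonneg ws by unfold_locales auto
  then show ?thesis by (rule that)
qed

theorem theorem1p1:
  fixes w :: "int^'n \<Rightarrow> int^'n \<Rightarrow> real" and h :: "int^'n \<Rightarrow> real"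
    and s a b p c C h0 :: real and x0 :: "int^'n"
  assumes s: "0 < s" "s < 1"
    and ab: "a > 0" "b > 0"
    and p: "p > 4"
    and cC: "0 < c" "c \<le> C"
    and w_sym: "\<And>x y. x \<noteq> y \<Longrightarrow> w x y = w y x"
    and w_pos: "\<And>x y. x \<noteq> y \<Longrightarrow> w x y > 0"
    and w_lower: "\<And>x y. x \<noteq> y \<Longrightarrow>
         c * real_of_int (dist1 x y) powr (- real CARD('n) - 2 * s) \<le> w x y"
    and w_upper: "\<And>x y. x \<noteq> y \<Longrightarrow>
         w x y \<le> C * real_of_int (dist1 x y) powr (- real CARD('n) - 2 * s)"
    and h1: "h0 > 0" "\<And>x. h x \<ge> h0"
    and h2: "\<And>M. \<exists>R. \<forall>x. real_of_int (dist1 x x0) \<ge> R \<longrightarrow> h x \<ge> M"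
  shows "\<exists>u \<in> Hsp w h. u \<in> Nehari w a b h p
           \<and> (\<forall>\<phi> \<in> Hsp w h. dJ w a b h p u \<phi> = 0)
           \<and> Jfun w a b h p u = (INF v \<in> Nehari w a b h p. Jfun w a b h p v)"
proof -
  obtain W where "summable_kernel w W"
    by (rule summable_kernel_of_decay[of "2 * s" w C]) (use s w_sym less_imp_le[OF w_pos] w_upper in auto)
  then interpret summable_kernel w W .
  have fin: "finite {x. h x < M}" for M
  proof -
    obtain R where R: "\<And>x. real_of_int (dist1 x x0) \<ge> R \<Longrightarrow> h x \<ge> M" using h2[of M] by blast
    define S where "S = (\<Union>i. {x0 $ i - \<lceil>R\<rceil>..x0 $ i + \<lceil>R\<rceil>})"
    have "{x. h x < M} \<subseteq> {y. \<forall>i. y $ i \<in> S}"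
    proof (intro subsetI CollectI allI)
      fix x i assume "x \<in> {x. h x < M}"
      then have "norm1 (x - x0) < R" using R[of x] by (force simp: dist1_eq_norm1)
      then have "\<bar>real_of_int ((x - x0) $ i)\<bar> < R" using coord_le_norm1[of "x - x0" i] by linarith
      then have "x $ i \<in> {x0 $ i - \<lceil>R\<rceil>..x0 $ i + \<lceil>R\<rceil>}" by (simp add: abs_less_iff) linarith
      then show "x $ i \<in> S" unfolding S_def by blast
    qed
    moreover have "finite S" unfolding S_def by auto
    ultimately show ?thesis using finite_vec_box finite_subset by blast
  qed
  interpret log_kirchhoff form h "2 * W" h0 a b p
  proof
    fix u v z :: "int^'n \<Rightarrow> real" and r :: real
    assume u: "u \<in> l2"
    show "0 \<le> form u u" unfolding form_def by (intro infsum_nonneg gradprod_nonneg)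
    show "form u u \<le> 2 * W * (\<Sum>\<^sub>\<infinity>x. (u x)\<^sup>2)" by (rule form_bound[OF u])
    assume v: "v \<in> l2"
    show "form (\<lambda>x. r * u x) v = r * form u v"
      by (simp add: form_def gradprod_scale infsum_cmult_right')
    show "form u v = form v u" by (simp add: form_def gradprod_sym[of u v])
    assume "z \<in> l2"
    then show "form (\<lambda>x. u x + v x) z = form u z + form v z"
      using u v by (simp add: form_def gradprod_add infsum_add gradprod_summable)
  qed (use h1 fin ab p in auto)
  have Hsp: "Hsp w h = Hs"
    unfolding Hsp_def Wsp_eq_l2 using Hs_l2 by (auto simp: Hs_def)
  have inner: "Hinner w a h u v = a * form u v + pot u v" if "u \<in> Hs" "v \<in> Hs" for u v
    unfolding Hinner_def form_def pot_def infsum_cmult_right'[symmetric]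
    by (rule infsum_add[OF summable_on_cmult_right[OF gradprod_summable] Hs_mult])
       (use that Hs_l2 in auto)
  have gn: "gradnorm2 w u = form u u" for u
    by (simp add: gradnorm2_def form_def gradsq_def)
  have J: "Jfun w a b h p u = nrg u" if "u \<in> Hs" for u
    using that by (simp add: Jfun_def nrg_def inner gn quad_def pw_def lg_def)
  have D: "dJ w a b h p u \<phi> = dnrg u \<phi>" if "u \<in> Hs" "\<phi> \<in> Hs" for u \<phi>
    using that by (simp add: dJ_def dnrg_def inner gn form_def)
  have N: "Nehari w a b h p = nehari"
    unfolding Nehari_def nehari_def Hsp using D by auto
  have nH: "nehari \<subseteq> Hs" by (auto simp: nehari_def)
  obtain u where u: "u \<in> nehari" "\<And>\<phi>. \<phi> \<in> Hs \<Longrightarrow> dnrg u \<phi> = 0" "nrg u = (INF v\<in>nehari. nrg v)"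
    by (rule ground_state_exists) blast
  have "(INF v\<in>nehari. Jfun w a b h p v) = (INF v\<in>nehari. nrg v)"
    using nH J by (intro INF_cong) auto
  then show ?thesis
    using u nH by (intro bexI[of _ u]) (auto simp: N Hsp J D subset_iff)
qed

end
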